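(* There are closed terms $s$ and $t$ (of Gödel's $T$) such that $\textsf{E-PA}^{\omega*}$ proves \[ (\forall \Omega)\big(\textsf{MUC}(\Omega)\rightarrow \textsf{SFF}(t(\Omega))\big)\ \wedge\ (\forall \Theta)\big(\textsf{SFF}(\Theta)\rightarrow \textsf{FAN}_{\textsf{ef}}(s(\Theta))\big). \]
   Context: Types: $0$ is the type of natural numbers, $1=0\to0$, $2=1\to 0$, and $\tau^*$ is the type of finite sequences of objects of type $\tau$. $\textsf{E-PA}^{\omega}$ is (classical) Peano arithmetic in all finite types with the axiom of extensionality; $\textsf{E-PA}^{\omega*}$ is its definitional extension with types $\tau^*$ for finite sequences. Its closed terms are those of Gödel's $T$ (with finite sequence types). For $w$ of type $\tau^*$, $g\in w$ means that $g$ equals one of the entries of $w$. $f\leq_1 1$ means $f(n)\le 1$ for all $n$. For $f^1$ and $N^0$, $\overline{f}N=\langle f(0),\dots,f(N-1)\rangle$ is the initial segment of $f$ of length $N$; for a finite sequence $\sigma$ of numbers, $f\in[\sigma]$ means that $f$ extends $\sigma$. A variable $T\leq_1 1$ followed by membership "$\sigma\in T$" ranges over binary trees (downward closed sets of finite binary sequences, given by their characteristic functions). $\textsf{MUC}(\Omega)$, for $\Omega$ of type $2\to 0$ (the intuitionistic fan functional): $(\forall Y^{2})(\forall f^1,g^1\leq_1 1)\big(\overline{f}\Omega(Y)=\overline{g}\Omega(Y)\rightarrow Y(f)=Y(g)\big)$. $\textsf{SFF}(\Theta)$, for $\Theta$ of type $2\to1^*$ (special fan functional): $(\forall G^2)(\forall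 f^1\leq_1 1)(\exists g\in\Theta(G))\big(f\in[\overline{g}G(g)]\big)$. $\textsf{FAN}_{\textsf{ef}}(h)$, for $h$ of type $(2\times 1)\to 0$: $(\forall T\leq_1 1)(\forall g^2)\big[(\forall\alpha\leq_1 1)(\overline{\alpha}g(\alpha)\notin T)\rightarrow(\forall\beta\leq_1 1)(\overline{\beta}h(g,T)\notin T)\big]$. *)

theory Defs
  imports Main
begin

text \<open>
  A deep embedding of \<open>E-PA\<^sup>\<omega>\<^sup>*\<close>: classical Peano arithmetic in all finite types with extensionality
  and with types for finite sequences.  The terms are those of Goedel's \<open>T\<close>, generated by
  application from typed variables and combinators.  Equality is primitive at all types (as in
  Troelstra's \<open>N-HA\<^sup>\<omega>\<close> plus extensionality), and provability is derivability in natural deduction.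
\<close>

section \<open>Types and terms\<close>

datatype ty =
    TNat
  | TFun ty ty   (infixr "\<rightarrow>\<^sub>T" 60)
  | TProd ty ty  (infixr "\<times>\<^sub>T" 65)
  | TSeq ty

abbreviation ty1 :: ty where "ty1 \<equiv> TNat \<rightarrow>\<^sub>T TNat"
abbreviation ty2 :: ty where "ty2 \<equiv> ty1 \<rightarrow>\<^sub>T TNat"

text \<open>A variable is identified by its name together with its type.\<close>

type_synonym var = "string \<times> ty"

datatype cst =
    Zero
  | Succ
  | Kc ty ty
  | Sc ty ty ty
  | Rc ty
  | Pairc ty ty
  | Fstc ty ty
  | Sndc ty ty
  | Nilc ty
  | Consc ty
  | Lc ty ty     \<comment> \<open>list recursion, from sequences over the first type into the second\<close>

fun cst_ty :: "cst \<Rightarrow> ty" where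
  "cst_ty Zero = TNat"
| "cst_ty Succ = TNat \<rightarrow>\<^sub>T TNat"
| "cst_ty (Kc \<sigma> \<tau>) = \<sigma> \<rightarrow>\<^sub>T \<tau> \<rightarrow>\<^sub>T \<sigma>"
| "cst_ty (Sc \<sigma> \<tau> \<rho>) = (\<sigma> \<rightarrow>\<^sub>T \<tau> \<rightarrow>\<^sub>T \<rho>) \<rightarrow>\<^sub>T (\<sigma> \<rightarrow>\<^sub>T \<tau>) \<rightarrow>\<^sub>T \<sigma> \<rightarrow>\<^sub>T \<rho>"
| "cst_ty (Rc \<tau>) = TNat \<rightarrow>\<^sub>T \<tau> \<rightarrow>\<^sub>T (\<tau> \<rightarrow>\<^sub>T TNat \<rightarrow>\<^sub>T \<tau>) \<rightarrow>\<^sub>T \<tau>"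
| "cst_ty (Pairc \<sigma> \<tau>) = \<sigma> \<rightarrow>\<^sub>T \<tau> \<rightarrow>\<^sub>T \<sigma> \<times>\<^sub>T \<tau>"
| "cst_ty (Fstc \<sigma> \<tau>) = \<sigma> \<times>\<^sub>T \<tau> \<rightarrow>\<^sub>T \<sigma>"
| "cst_ty (Sndc \<sigma> \<tau>) = \<sigma> \<times>\<^sub>T \<tau> \<rightarrow>\<^sub>T \<tau>"
| "cst_ty (Nilc \<sigma>) = TSeq \<sigma>"
| "cst_ty (Consc \<sigma>) = \<sigma> \<rightarrow>\<^sub>T TSeq \<sigma> \<rightarrow>\<^sub>T TSeq \<sigma>"
| "cst_ty (Lc \<sigma> \<tau>) = TSeq \<sigma> \<rightarrow>\<^sub>T \<tau> \<rightarrow>\<^sub>T (\<tau> \<rightarrow>\<^sub>T \<sigma> \<rightarrow>\<^sub>T \<tau>) \<rightarrow>\<^sub>T \<tau>"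

datatype tm =
    Var var
  | Con cst
  | App tm tm  (infixl "\<cdot>" 90)

fun tyof :: "tm \<Rightarrow> ty option" where
  "tyof (Var x) = Some (snd x)"
| "tyof (Con c) = Some (cst_ty c)"
| "tyof (t \<cdot> u) =
    (case tyof t of
       Some (\<sigma> \<rightarrow>\<^sub>T \<tau>) \<Rightarrow> (if tyof u = Some \<sigma> then Some \<tau> else None)
     | _ \<Rightarrow> None)"

fun vars :: "tm \<Rightarrow> var set" where
  "vars (Var x) = {x}"
| "vars (Con c) = {}"
| "vars (t \<cdot> u) = vars t \<union> vars u"

definition closed_term :: "tm \<Rightarrow> ty \<Rightarrow> bool" where
  "closed_term t \<tau> \<longleftrightarrow> vars t = {} \<and> tyof t = Some \<tau>"

fun tsubst :: "var \<Rightarrow> tm \<Rightarrow> tm \<Rightarrow> tm" where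
  "tsubst x s (Var y) = (if y = x then s else Var y)"
| "tsubst x s (Con c) = Con c"
| "tsubst x s (t \<cdot> u) = tsubst x s t \<cdot> tsubst x s u"

section \<open>Formulas\<close>

datatype fm =
    Eq tm tm         (infix "\<^bold>=" 50)
  | Fls
  | Conj fm fm       (infixr "\<^bold>\<and>" 35)
  | Disj fm fm       (infixr "\<^bold>\<or>" 30)
  | Imp fm fm        (infixr "\<^bold>\<longrightarrow>" 25)
  | Forall var fm
  | Exists var fm

abbreviation Neg :: "fm \<Rightarrow> fm" where "Neg \<phi> \<equiv> \<phi> \<^bold>\<longrightarrow> Fls"

fun wff :: "fm \<Rightarrow> bool" where
  "wff (t \<^bold>= u) \<longleftrightarrow> tyof t \<noteq> None \<and> tyof t = tyof u"
| "wff Fls \<longleftrightarrow> True"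
| "wff (\<phi> \<^bold>\<and> \<psi>) \<longleftrightarrow> wff \<phi> \<and> wff \<psi>"
| "wff (\<phi> \<^bold>\<or> \<psi>) \<longleftrightarrow> wff \<phi> \<and> wff \<psi>"
| "wff (\<phi> \<^bold>\<longrightarrow> \<psi>) \<longleftrightarrow> wff \<phi> \<and> wff \<psi>"
| "wff (Forall x \<phi>) \<longleftrightarrow> wff \<phi>"
| "wff (Exists x \<phi>) \<longleftrightarrow> wff \<phi>"

fun fvs :: "fm \<Rightarrow> var set" where
  "fvs (t \<^bold>= u) = vars t \<union> vars u"
| "fvs Fls = {}"
| "fvs (\<phi> \<^bold>\<and> \<psi>) = fvs \<phi> \<union> fvs \<psi>"
| "fvs (\<phi> \<^bold>\<or> \<psi>) = fvs \<phi> \<union> fvs \<psi>"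
| "fvs (\<phi> \<^bold>\<longrightarrow> \<psi>) = fvs \<phi> \<union> fvs \<psi>"
| "fvs (Forall x \<phi>) = fvs \<phi> - {x}"
| "fvs (Exists x \<phi>) = fvs \<phi> - {x}"

text \<open>Substitution does not rename bound variables; \<open>free_for\<close> says that no capture occurs.\<close>

fun fsubst :: "var \<Rightarrow> tm \<Rightarrow> fm \<Rightarrow> fm" where
  "fsubst x s (t \<^bold>= u) = (tsubst x s t \<^bold>= tsubst x s u)"
| "fsubst x s Fls = Fls"
| "fsubst x s (\<phi> \<^bold>\<and> \<psi>) = (fsubst x s \<phi> \<^bold>\<and> fsubst x s \<psi>)"
| "fsubst x s (\<phi> \<^bold>\<or> \<psi>) = (fsubst x s \<phi> \<^bold>\<or> fsubst x s \<psi>)"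
| "fsubst x s (\<phi> \<^bold>\<longrightarrow> \<psi>) = (fsubst x s \<phi> \<^bold>\<longrightarrow> fsubst x s \<psi>)"
| "fsubst x s (Forall y \<phi>) = Forall y (if y = x then \<phi> else fsubst x s \<phi>)"
| "fsubst x s (Exists y \<phi>) = Exists y (if y = x then \<phi> else fsubst x s \<phi>)"

fun free_for :: "tm \<Rightarrow> var \<Rightarrow> fm \<Rightarrow> bool" where
  "free_for s x (t \<^bold>= u) \<longleftrightarrow> True"
| "free_for s x Fls \<longleftrightarrow> True"
| "free_for s x (\<phi> \<^bold>\<and> \<psi>) \<longleftrightarrow> free_for s x \<phi> \<and> free_for s x \<psi>"
| "free_for s x (\<phi> \<^bold>\<or> \<psi>) \<longleftrightarrow> free_for s x \<phi> \<and> free_for s x \<psi>"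
| "free_for s x (\<phi> \<^bold>\<longrightarrow> \<psi>) \<longleftrightarrow> free_for s x \<phi> \<and> free_for s x \<psi>"
| "free_for s x (Forall y \<phi>) \<longleftrightarrow> x \<notin> fvs (Forall y \<phi>) \<or> (y \<notin> vars s \<and> free_for s x \<phi>)"
| "free_for s x (Exists y \<phi>) \<longleftrightarrow> x \<notin> fvs (Exists y \<phi>) \<or> (y \<notin> vars s \<and> free_for s x \<phi>)"

section \<open>The theory \<open>E-PA\<^sup>\<omega>\<^sup>*\<close>\<close>

text \<open>
  The axioms are schematic in all terms and formulas; the derivability relation below admits only
  their well-typed instances.  Induction on sequences follows from \<open>seq_cases\<close> by induction on
  the length.
\<close>

inductive axm :: "fm \<Rightarrow> bool" where
  eq_refl: "axm (t \<^bold>= t)"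
| eq_subst: "\<lbrakk>tyof t = Some (snd x); tyof u = Some (snd x); free_for t x \<phi>; free_for u x \<phi>\<rbrakk> \<Longrightarrow>
    axm (t \<^bold>= u \<^bold>\<longrightarrow> fsubst x t \<phi> \<^bold>\<longrightarrow> fsubst x u \<phi>)"
| ext: "\<lbrakk>x \<notin> vars t; x \<notin> vars u\<rbrakk> \<Longrightarrow>
    axm (Forall x (t \<cdot> Var x \<^bold>= u \<cdot> Var x) \<^bold>\<longrightarrow> t \<^bold>= u)"
| succ_not_zero: "axm (Neg (Con Succ \<cdot> t \<^bold>= Con Zero))"
| succ_inject: "axm (Con Succ \<cdot> t \<^bold>= Con Succ \<cdot> u \<^bold>\<longrightarrow> t \<^bold>= u)"
| induction: "snd x = TNat \<Longrightarrow>
    axm (fsubst x (Con Zero) \<phi> \<^bold>\<longrightarrow> Forall x (\<phi> \<^bold>\<longrightarrow> fsubst x (Con Succ \<cdot> Var x) \<phi>) \<^bold>\<longrightarrow> Forall x \<phi>)"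
| K: "axm (Con (Kc \<sigma> \<tau>) \<cdot> t \<cdot> u \<^bold>= t)"
| S: "axm (Con (Sc \<sigma> \<tau> \<rho>) \<cdot> t \<cdot> u \<cdot> v \<^bold>= t \<cdot> v \<cdot> (u \<cdot> v))"
| R_zero: "axm (Con (Rc \<tau>) \<cdot> Con Zero \<cdot> t \<cdot> u \<^bold>= t)"
| R_succ: "axm (Con (Rc \<tau>) \<cdot> (Con Succ \<cdot> n) \<cdot> t \<cdot> u \<^bold>= u \<cdot> (Con (Rc \<tau>) \<cdot> n \<cdot> t \<cdot> u) \<cdot> n)"
| fst_pair: "axm (Con (Fstc \<sigma> \<tau>) \<cdot> (Con (Pairc \<sigma> \<tau>) \<cdot> t \<cdot> u) \<^bold>= t)"
| snd_pair: "axm (Con (Sndc \<sigma> \<tau>) \<cdot> (Con (Pairc \<sigma> \<tau>) \<cdot> t \<cdot> u) \<^bold>= u)"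
| pair_surj: "axm (Con (Pairc \<sigma> \<tau>) \<cdot> (Con (Fstc \<sigma> \<tau>) \<cdot> t) \<cdot> (Con (Sndc \<sigma> \<tau>) \<cdot> t) \<^bold>= t)"
| seq_cases: "\<lbrakk>w = (''w'', TSeq \<sigma>); a = (''a'', \<sigma>); v = (''v'', TSeq \<sigma>)\<rbrakk> \<Longrightarrow>
    axm (Forall w (Var w \<^bold>= Con (Nilc \<sigma>) \<^bold>\<or>
           Exists a (Exists v (Var w \<^bold>= Con (Consc \<sigma>) \<cdot> Var a \<cdot> Var v))))"
| L_nil: "axm (Con (Lc \<sigma> \<tau>) \<cdot> Con (Nilc \<sigma>) \<cdot> t \<cdot> u \<^bold>= t)"
| L_cons: "axm (Con (Lc \<sigma> \<tau>) \<cdot> (Con (Consc \<sigma>) \<cdot> a \<cdot> v) \<cdot> t \<cdot> u \<^bold>=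
    u \<cdot> (Con (Lc \<sigma> \<tau>) \<cdot> v \<cdot> t \<cdot> u) \<cdot> a)"

inductive proves :: "fm set \<Rightarrow> fm \<Rightarrow> bool" (infix "\<turnstile>" 20) where
  ax: "\<lbrakk>axm \<phi>; wff \<phi>\<rbrakk> \<Longrightarrow> \<Gamma> \<turnstile> \<phi>"
| hyp: "\<lbrakk>\<phi> \<in> \<Gamma>; wff \<phi>\<rbrakk> \<Longrightarrow> \<Gamma> \<turnstile> \<phi>"
| weaken: "\<lbrakk>\<Gamma> \<turnstile> \<phi>; \<Gamma> \<subseteq> \<Delta>\<rbrakk> \<Longrightarrow> \<Delta> \<turnstile> \<phi>"
| conjI: "\<lbrakk>\<Gamma> \<turnstile> \<phi>; \<Gamma> \<turnstile> \<psi>\<rbrakk> \<Longrightarrow> \<Gamma> \<turnstile> \<phi> \<^bold>\<and> \<psi>"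
| conjE1: "\<Gamma> \<turnstile> \<phi> \<^bold>\<and> \<psi> \<Longrightarrow> \<Gamma> \<turnstile> \<phi>"
| conjE2: "\<Gamma> \<turnstile> \<phi> \<^bold>\<and> \<psi> \<Longrightarrow> \<Gamma> \<turnstile> \<psi>"
| disjI1: "\<lbrakk>\<Gamma> \<turnstile> \<phi>; wff \<psi>\<rbrakk> \<Longrightarrow> \<Gamma> \<turnstile> \<phi> \<^bold>\<or> \<psi>"
| disjI2: "\<lbrakk>\<Gamma> \<turnstile> \<psi>; wff \<phi>\<rbrakk> \<Longrightarrow> \<Gamma> \<turnstile> \<phi> \<^bold>\<or> \<psi>"
| disjE: "\<lbrakk>\<Gamma> \<turnstile> \<phi> \<^bold>\<or> \<psi>; insert \<phi> \<Gamma> \<turnstile> \<chi>; insert \<psi> \<Gamma> \<turnstile> \<chi>\<rbrakk> \<Longrightarrow> \<Gamma> \<turnstile> \<chi>"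
| impI: "\<lbrakk>insert \<phi> \<Gamma> \<turnstile> \<psi>; wff \<phi>\<rbrakk> \<Longrightarrow> \<Gamma> \<turnstile> \<phi> \<^bold>\<longrightarrow> \<psi>"
| impE: "\<lbrakk>\<Gamma> \<turnstile> \<phi> \<^bold>\<longrightarrow> \<psi>; \<Gamma> \<turnstile> \<phi>\<rbrakk> \<Longrightarrow> \<Gamma> \<turnstile> \<psi>"
| classical: "\<lbrakk>insert (Neg \<phi>) \<Gamma> \<turnstile> Fls; wff \<phi>\<rbrakk> \<Longrightarrow> \<Gamma> \<turnstile> \<phi>"
| allI: "\<lbrakk>\<Gamma> \<turnstile> \<phi>; \<forall>\<gamma>\<in>\<Gamma>. x \<notin> fvs \<gamma>\<rbrakk> \<Longrightarrow> \<Gamma> \<turnstile> Forall x \<phi>"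
| allE: "\<lbrakk>\<Gamma> \<turnstile> Forall x \<phi>; tyof t = Some (snd x); free_for t x \<phi>\<rbrakk> \<Longrightarrow> \<Gamma> \<turnstile> fsubst x t \<phi>"
| exI: "\<lbrakk>\<Gamma> \<turnstile> fsubst x t \<phi>; wff \<phi>; tyof t = Some (snd x); free_for t x \<phi>\<rbrakk> \<Longrightarrow> \<Gamma> \<turnstile> Exists x \<phi>"
| exE: "\<lbrakk>\<Gamma> \<turnstile> Exists x \<phi>; insert \<phi> \<Gamma> \<turnstile> \<psi>; \<forall>\<gamma>\<in>\<Gamma>. x \<notin> fvs \<gamma>; x \<notin> fvs \<psi>\<rbrakk> \<Longrightarrow> \<Gamma> \<turnstile> \<psi>"

section \<open>Bracket abstraction\<close>

text \<open>\<open>lam x t\<close> is a combinator term for \<open>\<lambda>x. t\<close>, for well-typed \<open>t\<close>; the junk values for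
  ill-typed \<open>t\<close> are irrelevant.\<close>

definition ty_the :: "tm \<Rightarrow> ty" where
  "ty_the t = (case tyof t of Some \<tau> \<Rightarrow> \<tau> | None \<Rightarrow> TNat)"

fun ty_cod :: "ty \<Rightarrow> ty" where
  "ty_cod (\<sigma> \<rightarrow>\<^sub>T \<tau>) = \<tau>"
| "ty_cod \<sigma> = \<sigma>"

definition I_tm :: "ty \<Rightarrow> tm" where
  "I_tm \<sigma> = Con (Sc \<sigma> (\<sigma> \<rightarrow>\<^sub>T \<sigma>) \<sigma>) \<cdot> Con (Kc \<sigma> (\<sigma> \<rightarrow>\<^sub>T \<sigma>)) \<cdot> Con (Kc \<sigma> \<sigma>)"

fun lam :: "var \<Rightarrow> tm \<Rightarrow> tm" where
  "lam x (Var y) = (if y = x then I_tm (snd x) else Con (Kc (snd y) (snd x)) \<cdot> Var y)"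
| "lam x (Con c) = Con (Kc (cst_ty c) (snd x)) \<cdot> Con c"
| "lam x (t \<cdot> u) =
    (if x \<notin> vars (t \<cdot> u) then Con (Kc (ty_the (t \<cdot> u)) (snd x)) \<cdot> (t \<cdot> u)
     else Con (Sc (snd x) (ty_the u) (ty_cod (ty_the t))) \<cdot> lam x t \<cdot> lam x u)"

section \<open>Closed terms for basic operations\<close>

text \<open>All operations are closed terms, so that applying them to terms never captures variables.\<close>

definition pred_tm :: tm where
  "pred_tm =
    (let m = (''m'', TNat); p = (''p'', TNat); n = (''n'', TNat) in
     lam m (Con (Rc TNat) \<cdot> Var m \<cdot> Con Zero \<cdot> lam p (lam n (Var n))))"

definition plus_tm :: tm where
  "plus_tm =
    (let k = (''k'', TNat); m = (''m'', TNat); p = (''p'', TNat); n = (''n'', TNat) in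
     lam k (lam m (Con (Rc TNat) \<cdot> Var m \<cdot> Var k \<cdot> lam p (lam n (Con Succ \<cdot> Var p)))))"

definition monus_tm :: tm where
  "monus_tm =
    (let k = (''k'', TNat); m = (''m'', TNat); p = (''p'', TNat); n = (''n'', TNat) in
     lam k (lam m (Con (Rc TNat) \<cdot> Var m \<cdot> Var k \<cdot> lam p (lam n (pred_tm \<cdot> Var p)))))"

definition len_tm :: "ty \<Rightarrow> tm" where
  "len_tm \<sigma> =
    (let w = (''w'', TSeq \<sigma>); p = (''p'', TNat); a = (''a'', \<sigma>) in
     lam w (Con (Lc \<sigma> TNat) \<cdot> Var w \<cdot> Con Zero \<cdot> lam p (lam a (Con Succ \<cdot> Var p))))"

definition append_tm :: "ty \<Rightarrow> tm" where
  "append_tm \<sigma> =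
    (let w = (''w'', TSeq \<sigma>); v = (''v'', TSeq \<sigma>); p = (''p'', TSeq \<sigma>); a = (''a'', \<sigma>) in
     lam w (lam v (Con (Lc \<sigma> (TSeq \<sigma>)) \<cdot> Var w \<cdot> Var v \<cdot>
       lam p (lam a (Con (Consc \<sigma>) \<cdot> Var a \<cdot> Var p)))))"

text \<open>The canonical closed object of each type, used as the value of out-of-range entries.\<close>

fun zero_tm :: "ty \<Rightarrow> tm" where
  "zero_tm TNat = Con Zero"
| "zero_tm (\<sigma> \<rightarrow>\<^sub>T \<tau>) = Con (Kc \<tau> \<sigma>) \<cdot> zero_tm \<tau>"
| "zero_tm (\<sigma> \<times>\<^sub>T \<tau>) = Con (Pairc \<sigma> \<tau>) \<cdot> zero_tm \<sigma> \<cdot> zero_tm \<tau>"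
| "zero_tm (TSeq \<sigma>) = Con (Nilc \<sigma>)"

text \<open>
  \<open>entry_tm \<sigma> \<cdot> w \<cdot> i\<close> is the \<open>i\<close>-th entry of \<open>w\<close>, counted from 0: recursion on \<open>w\<close> with values in
  \<open>TNat \<rightarrow>\<^sub>T \<sigma>\<close>, sending a head \<open>a\<close> and the entry function \<open>p\<close> of the tail to
  \<open>0 \<mapsto> a, Suc j \<mapsto> p j\<close>.
\<close>

definition entry_tm :: "ty \<Rightarrow> tm" where
  "entry_tm \<sigma> =
    (let w = (''w'', TSeq \<sigma>); p = (''p'', TNat \<rightarrow>\<^sub>T \<sigma>); a = (''a'', \<sigma>);
         i = (''i'', TNat); q = (''q'', \<sigma>); j = (''j'', TNat) in
     lam w (Con (Lc \<sigma> (TNat \<rightarrow>\<^sub>T \<sigma>)) \<cdot> Var w \<cdot> zero_tm (TNat \<rightarrow>\<^sub>T \<sigma>) \<cdot>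
       lam p (lam a (lam i (Con (Rc \<sigma>) \<cdot> Var i \<cdot> Var a \<cdot> lam q (lam j (Var p \<cdot> Var j)))))))"

text \<open>\<open>initseg_tm \<cdot> f \<cdot> N\<close> is the sequence of the values \<open>f 0, \<dots>, f (N - 1)\<close>.\<close>

definition initseg_tm :: tm where
  "initseg_tm =
    (let f = (''f'', ty1); N = (''N'', TNat); p = (''p'', TSeq TNat); n = (''n'', TNat) in
     lam f (lam N (Con (Rc (TSeq TNat)) \<cdot> Var N \<cdot> Con (Nilc TNat) \<cdot>
       lam p (lam n (append_tm TNat \<cdot> Var p \<cdot>
         (Con (Consc TNat) \<cdot> (Var f \<cdot> Var n) \<cdot> Con (Nilc TNat)))))))"

text \<open>
  Binary trees are objects of type 1, so finite binary sequences are coded by numbers: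
  the empty sequence has code 0, and prepending \<open>a\<close> to a sequence with code \<open>c\<close> gives the
  code \<open>2 * c + 1 + a\<close>.  On binary sequences this is a bijection onto the natural numbers.
\<close>

definition code_tm :: tm where
  "code_tm =
    (let w = (''w'', TSeq TNat); p = (''p'', TNat); a = (''a'', TNat) in
     lam w (Con (Lc TNat TNat) \<cdot> Var w \<cdot> Con Zero \<cdot>
       lam p (lam a (Con Succ \<cdot> (plus_tm \<cdot> (plus_tm \<cdot> Var p \<cdot> Var p) \<cdot> Var a)))))"

section \<open>The principles\<close>

text \<open>
  The definitions below take terms as parameters and quantify over variables with fixed names.
  Such a parameter must not contain any of these variables.
\<close>

abbreviation one :: tm where "one \<equiv> Con Succ \<cdot> Con Zero"

text \<open>\<open>m \<le> n\<close> is expressed with cut-off subtraction.\<close>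

abbreviation Le :: "tm \<Rightarrow> tm \<Rightarrow> fm" where "Le m n \<equiv> (monus_tm \<cdot> m \<cdot> n \<^bold>= Con Zero)"
abbreviation Less :: "tm \<Rightarrow> tm \<Rightarrow> fm" where "Less m n \<equiv> Le (Con Succ \<cdot> m) n"

abbreviation initseg :: "tm \<Rightarrow> tm \<Rightarrow> tm" where "initseg f N \<equiv> initseg_tm \<cdot> f \<cdot> N"
abbreviation len :: "ty \<Rightarrow> tm \<Rightarrow> tm" where "len \<sigma> w \<equiv> len_tm \<sigma> \<cdot> w"
abbreviation entry :: "ty \<Rightarrow> tm \<Rightarrow> tm \<Rightarrow> tm" where "entry \<sigma> w i \<equiv> entry_tm \<sigma> \<cdot> w \<cdot> i"
abbreviation seqapp :: "ty \<Rightarrow> tm \<Rightarrow> tm \<Rightarrow> tm" where "seqapp \<sigma> w v \<equiv> append_tm \<sigma> \<cdot> w \<cdot> v"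

text \<open>\<open>f \<le>\<^sub>1 1\<close>\<close>

definition Binary :: "tm \<Rightarrow> fm" where
  "Binary f = (let n = (''n'', TNat) in Forall n (Le (f \<cdot> Var n) one))"

abbreviation ForallBin :: "var \<Rightarrow> fm \<Rightarrow> fm" where
  "ForallBin f \<phi> \<equiv> Forall f (Binary (Var f) \<^bold>\<longrightarrow> \<phi>)"

text \<open>\<open>g \<in> w\<close> for a finite sequence \<open>w\<close> of objects of type \<open>\<sigma>\<close>\<close>

definition InSeq :: "ty \<Rightarrow> tm \<Rightarrow> tm \<Rightarrow> fm" where
  "InSeq \<sigma> g w =
    (let i = (''i'', TNat) in Exists i (Less (Var i) (len \<sigma> w) \<^bold>\<and> g \<^bold>= entry \<sigma> w (Var i)))"

text \<open>\<open>f \<in> [w]\<close>: the function \<open>f\<close> extends the finite sequence \<open>w\<close> of numbers\<close>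

definition Extends :: "tm \<Rightarrow> tm \<Rightarrow> fm" where
  "Extends f w =
    (let i = (''i'', TNat) in
     Forall i (Less (Var i) (len TNat w) \<^bold>\<longrightarrow> f \<cdot> Var i \<^bold>= entry TNat w (Var i)))"

definition BinarySeq :: "tm \<Rightarrow> fm" where
  "BinarySeq w =
    (let i = (''i'', TNat) in
     Forall i (Less (Var i) (len TNat w) \<^bold>\<longrightarrow> Le (entry TNat w (Var i)) one))"

text \<open>\<open>w \<in> T\<close> for a finite binary sequence \<open>w\<close> and a set \<open>T\<close> given by its characteristic function\<close>

definition InTree :: "tm \<Rightarrow> tm \<Rightarrow> fm" where
  "InTree w T = (T \<cdot> (code_tm \<cdot> w) \<^bold>= one)"

definition Tree :: "tm \<Rightarrow> fm" where
  "Tree T =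
    (let u = (''u'', TSeq TNat); v = (''v'', TSeq TNat) in
     Binary T \<^bold>\<and>
     Forall u (Forall v
       (BinarySeq (Var u) \<^bold>\<longrightarrow> BinarySeq (Var v) \<^bold>\<longrightarrow>
        InTree (seqapp TNat (Var u) (Var v)) T \<^bold>\<longrightarrow> InTree (Var u) T)))"

definition MUC :: "tm \<Rightarrow> fm" where
  "MUC \<Omega> =
    (let Y = (''Y'', ty2); f = (''f'', ty1); g = (''g'', ty1) in
     Forall Y (ForallBin f (ForallBin g
       (initseg (Var f) (\<Omega> \<cdot> Var Y) \<^bold>= initseg (Var g) (\<Omega> \<cdot> Var Y) \<^bold>\<longrightarrow>
        Var Y \<cdot> Var f \<^bold>= Var Y \<cdot> Var g))))"

definition SFF :: "tm \<Rightarrow> fm" where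
  "SFF \<Theta> =
    (let G = (''G'', ty2); f = (''f'', ty1); g = (''g'', ty1) in
     Forall G (ForallBin f (Exists g
       (InSeq ty1 (Var g) (\<Theta> \<cdot> Var G) \<^bold>\<and>
        Extends (Var f) (initseg (Var g) (Var G \<cdot> Var g))))))"

definition FANef :: "tm \<Rightarrow> fm" where
  "FANef h =
    (let T = (''T'', ty1); g = (''g'', ty2); \<alpha> = (''alpha'', ty1); \<beta> = (''beta'', ty1) in
     Forall T (Tree (Var T) \<^bold>\<longrightarrow> Forall g
       (ForallBin \<alpha> (Neg (InTree (initseg (Var \<alpha>) (Var g \<cdot> Var \<alpha>)) (Var T))) \<^bold>\<longrightarrow>
        ForallBin \<beta> (Neg (InTree
          (initseg (Var \<beta>) (h \<cdot> (Con (Pairc ty2 ty1) \<cdot> Var g \<cdot> Var T))) (Var T))))))"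

end

theory Submission
  imports Defs "HOL-Library.Countable"
begin

text \<open>
  Derivability is reduced to truth: by a Henkin construction, a closed formula that holds in every
  model of the axioms (a typed applicative structure whose induction is restricted to formulas) is
  derivable, so both implications can be argued inside an arbitrary such model.

  From \<open>\<Omega>\<close> to \<open>\<Theta>\<close>: let \<open>N = \<Omega>(G)\<close>, and let \<open>M\<close> be the sum of \<open>G\<close> over the binary functions that
  vanish from \<open>N\<close> on.  Every value of \<open>G\<close> on a binary function occurs in that sum, so \<open>G \<le> M\<close> there, and
  the list \<open>\<Theta>(G)\<close> of the binary functions that vanish from \<open>N + M\<close> on is as required.

  From \<open>\<Theta>\<close> to \<open>h\<close>: put \<open>G(f) = g(min(f, 1))\<close> and let \<open>h(g, T)\<close> be the sum of \<open>G\<close> over \<open>\<Theta>(G)\<close>.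
\<close>

text \<open>Arguing semantically avoids explicit derivations through combinator reductions, at a
  price: the numbers of a model need not be numerals, so each induction on them has to be backed by
  a formula. Witnesses are variables, not new constants. Since substitution never renames, witness
  names and bound names are kept apart by length: the principles use names of at most five letters
  (attained by \<open>Omega\<close>, \<open>Theta\<close> and \<open>alpha\<close>), witnesses have
  at least six. Countability serves to enumerate the formulas.

  Both summands of N + M are at work: a binary f agrees with a listed g below N + M. Agreement below
  N gives G(g) = G(f), and this is at most M, so the agreement covers the whole segment of length
  G(g). In the other direction, some \<gamma> in \<Theta>(G) shares with \<beta> a segment of length
  G(\<gamma>); this segment lies outside T, and downward closure keeps all longer segments of
  \<beta> outside T. Sums replace maxima, because bounding every summand is all that is asked of
  them.\<close>

instance ty :: countable by countable_datatype
instance cst :: countable by countable_datatype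
instance tm :: countable by countable_datatype
instance fm :: countable by countable_datatype

section \<open>Substitution\<close>

fun bvs :: "fm \<Rightarrow> var set" where
  "bvs (t \<^bold>= u) = {}"
| "bvs Fls = {}"
| "bvs (\<phi> \<^bold>\<and> \<psi>) = bvs \<phi> \<union> bvs \<psi>"
| "bvs (\<phi> \<^bold>\<or> \<psi>) = bvs \<phi> \<union> bvs \<psi>"
| "bvs (\<phi> \<^bold>\<longrightarrow> \<psi>) = bvs \<phi> \<union> bvs \<psi>"
| "bvs (Forall x \<phi>) = insert x (bvs \<phi>)"
| "bvs (Exists x \<phi>) = insert x (bvs \<phi>)"

fun tsub :: "(var \<Rightarrow> tm) \<Rightarrow> tm \<Rightarrow> tm" where
  "tsub \<theta> (Var x) = \<theta> x"
| "tsub \<theta> (Con c) = Con c"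
| "tsub \<theta> (t \<cdot> u) = tsub \<theta> t \<cdot> tsub \<theta> u"

text \<open>Bound variables are left alone and may capture. This is harmless below, where the values
  of \<open>\<theta>\<close> contain only variables reserved for witnesses and the formulas bind
  none of these.\<close>

fun ssub :: "(var \<Rightarrow> tm) \<Rightarrow> fm \<Rightarrow> fm" where
  "ssub \<theta> (t \<^bold>= u) = (tsub \<theta> t \<^bold>= tsub \<theta> u)"
| "ssub \<theta> Fls = Fls"
| "ssub \<theta> (\<phi> \<^bold>\<and> \<psi>) = (ssub \<theta> \<phi> \<^bold>\<and> ssub \<theta> \<psi>)"
| "ssub \<theta> (\<phi> \<^bold>\<or> \<psi>) = (ssub \<theta> \<phi> \<^bold>\<or> ssub \<theta> \<psi>)"
| "ssub \<theta> (\<phi> \<^bold>\<longrightarrow> \<psi>) = (ssub \<theta> \<phi> \<^bold>\<longrightarrow> ssub \<theta> \<psi>)"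
| "ssub \<theta> (Forall x \<phi>) = Forall x (ssub (\<theta>(x := Var x)) \<phi>)"
| "ssub \<theta> (Exists x \<phi>) = Exists x (ssub (\<theta>(x := Var x)) \<phi>)"

lemma finite_vars [simp]: "finite (vars t)"
  by (induction t) auto

lemma finite_fvs [simp]: "finite (fvs \<phi>)"
  by (induction \<phi>) auto

lemma finite_bvs [simp]: "finite (bvs \<phi>)"
  by (induction \<phi>) auto

lemma tsubst_fresh [simp]: "x \<notin> vars t \<Longrightarrow> tsubst x s t = t"
  by (induction t) auto

lemma tsubst_Var_same [simp]: "tsubst x (Var x) t = t"
  by (induction t) auto

lemma tsubst_tsubst_Var: "w \<notin> vars t \<Longrightarrow> tsubst w s (tsubst x (Var w) t) = tsubst x s t"
  by (induction t) auto

lemma vars_tsubst: "vars (tsubst x s t) \<subseteq> vars s \<union> (vars t - {x})"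
  by (induction t) auto

lemma tyof_AppE:
  assumes "tyof (t \<cdot> u) = Some \<tau>"
  obtains \<sigma> where "tyof t = Some (\<sigma> \<rightarrow>\<^sub>T \<tau>)" "tyof u = Some \<sigma>"
  using assms by (auto split: option.splits ty.splits if_splits)

lemma tyof_tsubst [simp]: "tyof s = Some (snd x) \<Longrightarrow> tyof (tsubst x s t) = tyof t"
  by (induction t) (auto split: option.split ty.split)

lemma fsubst_fresh [simp]: "x \<notin> fvs \<phi> \<Longrightarrow> fsubst x s \<phi> = \<phi>"
  by (induction \<phi>) auto

lemma fsubst_Var_same [simp]: "fsubst x (Var x) \<phi> = \<phi>"
  by (induction \<phi>) auto

lemma fvs_fsubst: "fvs (fsubst x s \<phi>) \<subseteq> vars s \<union> (fvs \<phi> - {x})"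
proof (induction \<phi>)
  case (Eq t u)
  then show ?case using vars_tsubst[of x s t] vars_tsubst[of x s u] by auto
qed (auto split: if_splits)

lemma bvs_fsubst [simp]: "bvs (fsubst x s \<phi>) = bvs \<phi>"
  by (induction \<phi>) auto

lemma wff_fsubst [simp]: "tyof s = Some (snd x) \<Longrightarrow> wff (fsubst x s \<phi>) = wff \<phi>"
  by (induction \<phi>) auto

lemma fsubst_fsubst_Var:
  "w \<notin> fvs \<phi> \<Longrightarrow> w \<notin> bvs \<phi> \<Longrightarrow> fsubst w s (fsubst x (Var w) \<phi>) = fsubst x s \<phi>"
  by (induction \<phi>) (auto simp: tsubst_tsubst_Var)

text \<open>Capture requires a bound variable of \<open>\<phi>\<close> to occur in \<open>s\<close>.
  The side conditions of \<open>allE\<close>, \<open>exI\<close> and \<open>eq_subst\<close> are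
  discharged in this form.\<close>

lemma free_for_disjoint: "vars s \<inter> bvs \<phi> = {} \<Longrightarrow> free_for s x \<phi>"
  by (induction \<phi>) auto

lemma free_for_Var_same [simp]: "free_for (Var x) x \<phi>"
  by (induction \<phi>) auto

lemma free_for_Var_back:
  "w \<notin> fvs \<phi> \<Longrightarrow> w \<notin> bvs \<phi> \<Longrightarrow> free_for (Var x) w (fsubst x (Var w) \<phi>)"
  by (induction \<phi>) auto

lemma tsubst_tsub:
  "(\<And>z. z \<noteq> x \<Longrightarrow> x \<notin> vars (\<theta> z)) \<Longrightarrow>
    tsubst x s (tsub \<theta> t) = tsub (\<theta>(x := tsubst x s (\<theta> x))) t"
  by (induction t) auto

text \<open>The other values of \<open>\<theta>\<close> do not contain \<open>x\<close>, so a later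
  substitution for \<open>x\<close> changes only the value at \<open>x\<close>. Under a binder other
  than \<open>x\<close> the two updates commute.\<close>

lemma fsubst_ssub:
  "(\<And>z. z \<noteq> x \<Longrightarrow> x \<notin> vars (\<theta> z)) \<Longrightarrow>
    fsubst x s (ssub \<theta> \<phi>) = ssub (\<theta>(x := tsubst x s (\<theta> x))) \<phi>"
proof (induction \<phi> arbitrary: \<theta>)
  case (Forall y \<phi>)
  show ?case
  proof (cases "y = x")
    case False
    then have "fsubst x s (ssub (\<theta>(y := Var y)) \<phi>) =
        ssub ((\<theta>(y := Var y))(x := tsubst x s (\<theta> x))) \<phi>"
      using False Forall.prems by (subst Forall.IH) auto
    moreover have "(\<theta>(y := Var y))(x := tsubst x s (\<theta> x)) = (\<theta>(x := tsubst x s (\<theta> x)))(y := Var y)"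
      using False by (rule fun_upd_twist)
    ultimately show ?thesis using False by (simp del: fun_upd_apply)
  qed (simp del: fun_upd_apply)
next
  case (Exists y \<phi>)
  show ?case
  proof (cases "y = x")
    case False
    then have "fsubst x s (ssub (\<theta>(y := Var y)) \<phi>) =
        ssub ((\<theta>(y := Var y))(x := tsubst x s (\<theta> x))) \<phi>"
      using False Exists.prems by (subst Exists.IH) auto
    moreover have "(\<theta>(y := Var y))(x := tsubst x s (\<theta> x)) = (\<theta>(x := tsubst x s (\<theta> x)))(y := Var y)"
      using False by (rule fun_upd_twist)
    ultimately show ?thesis using False by (simp del: fun_upd_apply)
  qed (simp del: fun_upd_apply)
qed (simp_all add: tsubst_tsub)

lemma tsub_id: "(\<And>z. z \<in> vars t \<Longrightarrow> \<theta> z = Var z) \<Longrightarrow> tsub \<theta> t = t"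
  by (induction t) auto

lemma ssub_id: "(\<And>z. z \<in> fvs \<phi> \<Longrightarrow> \<theta> z = Var z) \<Longrightarrow> ssub \<theta> \<phi> = \<phi>"
  by (induction \<phi> arbitrary: \<theta>) (auto simp: tsub_id)

lemma tyof_tsub [simp]: "(\<And>z. tyof (\<theta> z) = Some (snd z)) \<Longrightarrow> tyof (tsub \<theta> t) = tyof t"
  by (induction t) (auto split: option.split ty.split)

lemma wff_ssub [simp]: "(\<And>z. tyof (\<theta> z) = Some (snd z)) \<Longrightarrow> wff (ssub \<theta> \<phi>) = wff \<phi>"
  by (induction \<phi> arbitrary: \<theta>) auto

lemma bvs_ssub [simp]: "bvs (ssub \<theta> \<phi>) = bvs \<phi>"
  by (induction \<phi> arbitrary: \<theta>) auto

lemma vars_tsub: "vars (tsub \<theta> t) = (\<Union>z\<in>vars t. vars (\<theta> z))"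
  by (induction t) auto

section \<open>Henkin sets\<close>

lemma proves_wff: "\<Gamma> \<turnstile> \<phi> \<Longrightarrow> wff \<phi>"
  by (induction rule: proves.induct) auto

text \<open>Cut, obtained by introducing and eliminating an implication.\<close>

lemma proves_insert: "insert \<phi> \<Gamma> \<turnstile> \<psi> \<Longrightarrow> \<Gamma> \<turnstile> \<phi> \<Longrightarrow> \<Gamma> \<turnstile> \<psi>"
  using impE impI proves_wff by blast

lemma falseE: "\<Gamma> \<turnstile> Fls \<Longrightarrow> wff \<phi> \<Longrightarrow> \<Gamma> \<turnstile> \<phi>"
  by (rule classical, erule weaken) auto

text \<open>The rule \<open>exE\<close> takes the bound variable itself as eigenvariable, but
  \<open>x\<close> may be free in \<open>\<Gamma>\<close>. The renaming is therefore derived from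
  the single premise, where \<open>x\<close> is not free, and reaches \<open>\<Gamma>\<close> by
  cut.\<close>

lemma exists_rename:
  assumes "\<Gamma> \<turnstile> Exists x \<phi>" and w: "w \<notin> fvs \<phi>" "w \<notin> bvs \<phi>" "w \<noteq> x" "snd w = snd x"
  shows "\<Gamma> \<turnstile> Exists w (fsubst x (Var w) \<phi>)"
proof -
  have wf: "wff \<phi>" using proves_wff[OF assms(1)] by simp
  have "{Exists x \<phi>} \<turnstile> Exists w (fsubst x (Var w) \<phi>)"
  proof (rule exE[where x = x and \<phi> = \<phi>])
    show "insert \<phi> {Exists x \<phi>} \<turnstile> Exists w (fsubst x (Var w) \<phi>)"
    proof (rule exI[where t = "Var x"])
      show "insert \<phi> {Exists x \<phi>} \<turnstile> fsubst w (Var x) (fsubst x (Var w) \<phi>)"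
        using w wf by (auto simp: fsubst_fsubst_Var intro: hyp)
    qed (use w wf in \<open>auto simp: free_for_Var_back\<close>)
    show "x \<notin> fvs (Exists w (fsubst x (Var w) \<phi>))"
      using fvs_fsubst[of x "Var w" \<phi>] w by auto
  qed (use wf in \<open>auto intro: hyp\<close>)
  then have "insert (Exists x \<phi>) \<Gamma> \<turnstile> Exists w (fsubst x (Var w) \<phi>)"
    by (rule weaken) auto
  then show ?thesis using assms(1) by (rule proves_insert)
qed

lemma exists_witness:
  assumes "\<Gamma> \<turnstile> Exists x \<phi>" "w \<notin> fvs \<phi>" "w \<notin> bvs \<phi>" "w \<noteq> x" "snd w = snd x"
    "\<forall>\<gamma>\<in>\<Gamma>. w \<notin> fvs \<gamma>" "w \<notin> fvs \<psi>" "insert (fsubst x (Var w) \<phi>) \<Gamma> \<turnstile> \<psi>"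
  shows "\<Gamma> \<turnstile> \<psi>"
  using exists_rename[OF assms(1-5)] assms(8,6,7) by (rule exE)

text \<open>With this half of the quantifier duality, witnesses for existential formulas also serve
  to refute universal ones.\<close>

lemma not_forall:
  assumes "wff \<phi>"
  shows "{Neg (Forall x \<phi>)} \<turnstile> Exists x (Neg \<phi>)"
proof (rule classical)
  let ?\<Gamma> = "insert (Neg (Exists x (Neg \<phi>))) {Neg (Forall x \<phi>)}"
  have "insert (Neg \<phi>) ?\<Gamma> \<turnstile> Exists x (Neg \<phi>)"
    by (rule exI[where t = "Var x"]) (use assms in \<open>auto intro: hyp\<close>)
  moreover have "insert (Neg \<phi>) ?\<Gamma> \<turnstile> Neg (Exists x (Neg \<phi>))"
    using assms by (auto intro: hyp)
  ultimately have "insert (Neg \<phi>) ?\<Gamma> \<turnstile> Fls" by (rule impE[rotated])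
  then have "?\<Gamma> \<turnstile> \<phi>" using assms by (rule classical)
  then have "?\<Gamma> \<turnstile> Forall x \<phi>" by (rule allI) auto
  moreover have "?\<Gamma> \<turnstile> Neg (Forall x \<phi>)" using assms by (auto intro: hyp)
  ultimately show "?\<Gamma> \<turnstile> Fls" by (rule impE[rotated])
qed (use assms in simp)

text \<open>The variables reserved as Henkin witnesses.  The bound variables of the formulas considered
  later have short names, so terms over \<open>W\<close> can be substituted into them without capture.\<close>

definition W :: "var set" where "W = {x. 5 < length (fst x)}"

text \<open>A letter repeated n + 6 times is a name with more than five letters, and each type has
  infinitely many such variables.\<close>

lemma ex_fresh:
  assumes "finite V"
  shows "\<exists>w. w \<in> W \<and> w \<notin> V \<and> snd w = \<tau>"
proof -
  have "inj (\<lambda>n. (replicate (n + 6) (CHR ''x''), \<tau>) :: var)"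
    by (rule injI) (metis Pair_inject add_right_cancel length_replicate)
  then have "infinite (range (\<lambda>n. (replicate (n + 6) (CHR ''x''), \<tau>) :: var))"
    using finite_imageD infinite_UNIV_nat by blast
  then obtain n where "(replicate (n + 6) (CHR ''x''), \<tau>) \<notin> V"
    using assms by (meson finite_subset image_subsetI)
  then show ?thesis
    by (intro HOL.exI[of _ "(replicate (n + 6) (CHR ''x''), \<tau>)"]) (simp add: W_def)
qed

text \<open>A maximal consistent set with witnesses. Closure is demanded only for finite sets of
  premises, so compactness of derivability never has to be proved.\<close>

definition henkin :: "fm set \<Rightarrow> bool" where
  "henkin H \<longleftrightarrow>
    (\<forall>F \<phi>. finite F \<longrightarrow> F \<subseteq> H \<longrightarrow> (F \<turnstile> \<phi>) \<longrightarrow> \<phi> \<in> H) \<and>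
    Fls \<notin> H \<and>
    (\<forall>\<phi>. wff \<phi> \<longrightarrow> \<phi> \<in> H \<or> Neg \<phi> \<in> H) \<and>
    (\<forall>x \<phi>. Exists x \<phi> \<in> H \<longrightarrow> (\<exists>w\<in>W. snd w = snd x \<and> fsubst x (Var w) \<phi> \<in> H)) \<and>
    (\<forall>\<phi>\<in>H. wff \<phi>)"

text \<open>The value is a set, so that formulas other than existential ones contribute nothing. The
  variable is new for \<open>\<Gamma>\<close> and for the body, and avoids the binders as well, as
  \<open>exists_rename\<close> requires.\<close>

fun witness :: "fm set \<Rightarrow> fm \<Rightarrow> fm set" where
  "witness \<Gamma> (Exists x \<phi>) =
    {fsubst x (Var (SOME w. w \<in> W \<and>
      w \<notin> \<Union>(fvs ` \<Gamma>) \<union> fvs \<phi> \<union> bvs \<phi> \<union> {x} \<and> snd w = snd x)) \<phi>}"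
| "witness \<Gamma> \<phi> = {}"

text \<open>Stage \<open>Suc n\<close> treats the formula with number \<open>n\<close>. Started from
  a finite set, all stages remain finite, hence a fresh witness is always available.\<close>

fun extension :: "fm set \<Rightarrow> nat \<Rightarrow> fm set" where
  "extension \<Gamma> 0 = \<Gamma>"
| "extension \<Gamma> (Suc n) =
    (let \<Delta> = extension \<Gamma> n; \<phi> = from_nat n in
     if wff \<phi> \<and> \<not> (insert \<phi> \<Delta> \<turnstile> Fls) then witness \<Delta> \<phi> \<union> insert \<phi> \<Delta> else \<Delta>)"

lemma finite_witness [simp]: "finite (witness \<Gamma> \<phi>)"
  by (cases \<phi>) auto

lemma witness_Exists:
  assumes "finite \<Gamma>"
  obtains w where "w \<in> W" "w \<notin> \<Union>(fvs ` \<Gamma>) \<union> fvs \<phi> \<union> bvs \<phi> \<union> {x}" "snd w = snd x"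
    "witness \<Gamma> (Exists x \<phi>) = {fsubst x (Var w) \<phi>}"
proof -
  define P where "P w \<longleftrightarrow> w \<in> W \<and> w \<notin> \<Union>(fvs ` \<Gamma>) \<union> fvs \<phi> \<union> bvs \<phi> \<union> {x} \<and> snd w = snd x" for w
  have "\<exists>w. P w"
    unfolding P_def by (rule ex_fresh) (use assms in auto)
  then have "P (SOME w. P w)" by (rule someI_ex)
  with that[of "SOME w. P w"] show thesis by (simp add: P_def)
qed

text \<open>Because the witness is fresh, a refutation from the witnessing instance becomes, by
  existential elimination, a refutation from \<open>\<phi>\<close> alone.\<close>

lemma witness_consistent:
  assumes "finite \<Gamma>" "\<not> (insert \<phi> \<Gamma> \<turnstile> Fls)" "wff \<phi>"
  shows "\<not> (witness \<Gamma> \<phi> \<union> insert \<phi> \<Gamma> \<turnstile> Fls)"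
proof (cases \<phi>)
  case (Exists x \<psi>)
  obtain w where w: "w \<notin> \<Union>(fvs ` \<Gamma>) \<union> fvs \<psi> \<union> bvs \<psi> \<union> {x}" "snd w = snd x"
    "witness \<Gamma> (Exists x \<psi>) = {fsubst x (Var w) \<psi>}"
    using witness_Exists[OF assms(1)] .
  show ?thesis
  proof
    assume "witness \<Gamma> \<phi> \<union> insert \<phi> \<Gamma> \<turnstile> Fls"
    then have "insert (fsubst x (Var w) \<psi>) (insert \<phi> \<Gamma>) \<turnstile> Fls"
      unfolding Exists w by (simp add: insert_commute)
    moreover have "insert \<phi> \<Gamma> \<turnstile> Exists x \<psi>" using Exists assms(3) by (auto intro: hyp)
    ultimately have "insert \<phi> \<Gamma> \<turnstile> Fls"
      using exists_witness[of "insert \<phi> \<Gamma>" x \<psi> w Fls] w Exists by auto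
    with assms(2) show False ..
  qed
qed (use assms in auto)

lemma ex_henkin:
  assumes con: "\<not> ({Neg \<phi>} \<turnstile> Fls)" and wf: "wff \<phi>"
  obtains H where "henkin H" "Neg \<phi> \<in> H"
proof -
  let ?S = "extension {Neg \<phi>}"
  define H where "H = (\<Union>n. ?S n)"
  have fin: "finite (?S n)" for n
    by (induction n) (auto simp: Let_def)
  have con: "\<not> (?S n \<turnstile> Fls)" for n
  proof (induction n)
    case (Suc n)
    then show ?case
      using witness_consistent[OF fin[of n], of "from_nat n"] by (auto simp: Let_def)
  qed (use con in simp)
  have mono: "m \<le> n \<Longrightarrow> ?S m \<subseteq> ?S n" for m n
    by (rule lift_Suc_mono_le[of ?S]) (auto simp: Let_def)
  \<comment> \<open>The stages increase, so the stages containing the finitely many elements all lie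
    in one of them.\<close>
  have sub: "\<exists>n. F \<subseteq> ?S n" if "finite F" "F \<subseteq> H" for F
    using that
  proof (induction F rule: finite_induct)
    case (insert \<psi> F)
    then obtain m n where "\<psi> \<in> ?S m" "F \<subseteq> ?S n" unfolding H_def by blast
    then have "insert \<psi> F \<subseteq> ?S (max m n)"
      using mono[of m "max m n"] mono[of n "max m n"] by auto
    then show ?case by blast
  qed auto
  have wffH: "wff \<psi>" if "\<psi> \<in> ?S n" for n \<psi>
    using that
  proof (induction n arbitrary: \<psi>)
    case (Suc n)
    show ?case
    proof (cases "\<psi> \<in> ?S n")
      case False
      have "wff \<chi>" if "wff \<phi>'" "\<chi> \<in> witness (?S n) \<phi>'" for \<phi>' \<chi>
      proof (cases \<phi>')
        case (Exists x \<eta>)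
        obtain w where "snd w = snd x" "witness (?S n) (Exists x \<eta>) = {fsubst x (Var w) \<eta>}"
          using witness_Exists[OF fin[of n]] by metis
        with that Exists show ?thesis by auto
      qed (use that in auto)
      with False Suc.prems show ?thesis by (auto simp: Let_def split: if_splits)
    qed (use Suc.IH in blast)
  qed (use wf in simp)
  \<comment> \<open>If \<open>\<psi>\<close> were refused at its own stage, then the later of the
    two stages would both derive \<open>\<psi>\<close> and refute it, and a cut would make it
    inconsistent.\<close>
  have closed: "\<psi> \<in> ?S (Suc (to_nat \<psi>))" if "?S n \<turnstile> \<psi>" for \<psi> n
  proof -
    let ?m = "to_nat \<psi>"
    have "\<not> (insert \<psi> (?S ?m) \<turnstile> Fls)"
    proof
      assume a: "insert \<psi> (?S ?m) \<turnstile> Fls"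
      have "insert \<psi> (?S (max n ?m)) \<turnstile> Fls"
        using a by (rule weaken) (use mono[of ?m "max n ?m"] in auto)
      moreover have "?S (max n ?m) \<turnstile> \<psi>"
        using that by (rule weaken) (use mono[of n "max n ?m"] in auto)
      ultimately show False using con proves_insert by blast
    qed
    with proves_wff[OF that] show ?thesis by (simp add: Let_def)
  qed
  have "\<psi> \<in> H" if F: "finite F" "F \<subseteq> H" "F \<turnstile> \<psi>" for F \<psi>
  proof -
    obtain n where "F \<subseteq> ?S n" using sub F by blast
    then have "?S n \<turnstile> \<psi>" using F(3) weaken by blast
    then show ?thesis using closed unfolding H_def by blast
  qed
  moreover have "Fls \<notin> H"
    using con hyp[of Fls] unfolding H_def by auto
  \<comment> \<open>A formula inconsistent with its own stage is refuted there, and the derivable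
    negation enters at the stage of its own number.\<close>
  moreover have "\<psi> \<in> H \<or> Neg \<psi> \<in> H" if "wff \<psi>" for \<psi>
  proof (cases "insert \<psi> (?S (to_nat \<psi>)) \<turnstile> Fls")
    case True
    then have "?S (to_nat \<psi>) \<turnstile> Neg \<psi>" using that by (rule impI)
    then show ?thesis using closed unfolding H_def by blast
  next
    case False
    then have "\<psi> \<in> ?S (Suc (to_nat \<psi>))" using that by (simp add: Let_def)
    then show ?thesis unfolding H_def by blast
  qed
  moreover have "\<exists>w\<in>W. snd w = snd x \<and> fsubst x (Var w) \<psi> \<in> H" if "Exists x \<psi> \<in> H" for x \<psi>
  proof -
    let ?\<chi> = "Exists x \<psi>"
    have "Exists x \<psi> \<in> (\<Union>n. ?S n)" using that unfolding H_def .
    then obtain n where n: "?\<chi> \<in> ?S n" by (rule UN_E)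
    \<comment> \<open>\<open>?\<chi>\<close> may have entered at another stage, for instance as a
      witnessing instance. Consistency of the later of the two stages shows that it is also accepted
      at its own stage, where its witness is added.\<close>
    have "\<not> (insert ?\<chi> (?S (to_nat ?\<chi>)) \<turnstile> Fls)"
    proof
      assume "insert ?\<chi> (?S (to_nat ?\<chi>)) \<turnstile> Fls"
      then have "?S (max n (to_nat ?\<chi>)) \<turnstile> Fls"
        by (rule weaken) (use n mono[of n "max n (to_nat ?\<chi>)"] mono[of "to_nat ?\<chi>" "max n (to_nat ?\<chi>)"] in auto)
      with con show False by blast
    qed
    then have *: "witness (?S (to_nat ?\<chi>)) ?\<chi> \<subseteq> ?S (Suc (to_nat ?\<chi>))"
      using wffH[OF n] by (auto simp: Let_def simp del: witness.simps)
    obtain w where "w \<in> W" "snd w = snd x" "witness (?S (to_nat ?\<chi>)) ?\<chi> = {fsubst x (Var w) \<psi>}"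
      using witness_Exists[OF fin] .
    with * show ?thesis unfolding H_def by blast
  qed
  moreover have "\<forall>\<psi>\<in>H. wff \<psi>" using wffH unfolding H_def by blast
  ultimately have "henkin H" unfolding henkin_def by blast
  moreover have "Neg \<phi> \<in> H"
    unfolding H_def by (rule UN_I[of 0]) auto
  ultimately show thesis by (rule that)
qed


declare split_paired_All [simp del] split_paired_Ex [simp del]

section \<open>Models\<close>

text \<open>Kept separate from \<open>model\<close> because the induction assumption there already
  speaks of \<open>sat\<close>. Equality is read as identity, so a model built from terms has to be
  a quotient.\<close>

locale interp =
  fixes D :: "ty \<Rightarrow> 'e set" and ap :: "'e \<Rightarrow> 'e \<Rightarrow> 'e" and cn :: "cst \<Rightarrow> 'e"
begin

fun ev :: "(var \<Rightarrow> 'e) \<Rightarrow> tm \<Rightarrow> 'e" where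
  "ev \<rho> (Var x) = \<rho> x"
| "ev \<rho> (Con c) = cn c"
| "ev \<rho> (t \<cdot> u) = ap (ev \<rho> t) (ev \<rho> u)"

fun sat :: "(var \<Rightarrow> 'e) \<Rightarrow> fm \<Rightarrow> bool" where
  "sat \<rho> (t \<^bold>= u) \<longleftrightarrow> ev \<rho> t = ev \<rho> u"
| "sat \<rho> Fls \<longleftrightarrow> False"
| "sat \<rho> (\<phi> \<^bold>\<and> \<psi>) \<longleftrightarrow> sat \<rho> \<phi> \<and> sat \<rho> \<psi>"
| "sat \<rho> (\<phi> \<^bold>\<or> \<psi>) \<longleftrightarrow> sat \<rho> \<phi> \<or> sat \<rho> \<psi>"
| "sat \<rho> (\<phi> \<^bold>\<longrightarrow> \<psi>) \<longleftrightarrow> (sat \<rho> \<phi> \<longrightarrow> sat \<rho> \<psi>)"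
| "sat \<rho> (Forall x \<phi>) \<longleftrightarrow> (\<forall>a\<in>D (snd x). sat (\<rho>(x := a)) \<phi>)"
| "sat \<rho> (Exists x \<phi>) \<longleftrightarrow> (\<exists>a\<in>D (snd x). sat (\<rho>(x := a)) \<phi>)"

definition env :: "(var \<Rightarrow> 'e) \<Rightarrow> bool" where
  "env \<rho> \<longleftrightarrow> (\<forall>x. \<rho> x \<in> D (snd x))"

end

locale model = interp D ap cn
  for D :: "ty \<Rightarrow> 'e set" and ap :: "'e \<Rightarrow> 'e \<Rightarrow> 'e" and cn :: "cst \<Rightarrow> 'e" +
  assumes cn_in [simp]: "cn c \<in> D (cst_ty c)"
    and ap_in: "f \<in> D (\<sigma> \<rightarrow>\<^sub>T \<tau>) \<Longrightarrow> a \<in> D \<sigma> \<Longrightarrow> ap f a \<in> D \<tau>"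
    and fun_ext: "f \<in> D (\<sigma> \<rightarrow>\<^sub>T \<tau>) \<Longrightarrow> g \<in> D (\<sigma> \<rightarrow>\<^sub>T \<tau>) \<Longrightarrow>
      (\<And>a. a \<in> D \<sigma> \<Longrightarrow> ap f a = ap g a) \<Longrightarrow> f = g"
    and Succ_not_Zero: "a \<in> D TNat \<Longrightarrow> ap (cn Succ) a \<noteq> cn Zero"
    and Succ_inject: "a \<in> D TNat \<Longrightarrow> b \<in> D TNat \<Longrightarrow> ap (cn Succ) a = ap (cn Succ) b \<Longrightarrow> a = b"
    and induct: "snd x = TNat \<Longrightarrow> x \<notin> W \<Longrightarrow> bvs \<phi> \<inter> W = {} \<Longrightarrow> wff \<phi> \<Longrightarrow> env \<rho> \<Longrightarrow>
      sat (\<rho>(x := cn Zero)) \<phi> \<Longrightarrow>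
      (\<And>a. a \<in> D TNat \<Longrightarrow> sat (\<rho>(x := a)) \<phi> \<Longrightarrow> sat (\<rho>(x := ap (cn Succ) a)) \<phi>) \<Longrightarrow>
      b \<in> D TNat \<Longrightarrow> sat (\<rho>(x := b)) \<phi>"
    and K: "a \<in> D \<sigma> \<Longrightarrow> b \<in> D \<tau> \<Longrightarrow> ap (ap (cn (Kc \<sigma> \<tau>)) a) b = a"
    and S: "a \<in> D (\<sigma> \<rightarrow>\<^sub>T \<tau> \<rightarrow>\<^sub>T \<upsilon>) \<Longrightarrow> b \<in> D (\<sigma> \<rightarrow>\<^sub>T \<tau>) \<Longrightarrow> d \<in> D \<sigma> \<Longrightarrow>
      ap (ap (ap (cn (Sc \<sigma> \<tau> \<upsilon>)) a) b) d = ap (ap a d) (ap b d)"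
    and R_Zero: "a \<in> D \<tau> \<Longrightarrow> f \<in> D (\<tau> \<rightarrow>\<^sub>T TNat \<rightarrow>\<^sub>T \<tau>) \<Longrightarrow>
      ap (ap (ap (cn (Rc \<tau>)) (cn Zero)) a) f = a"
    and R_Succ: "n \<in> D TNat \<Longrightarrow> a \<in> D \<tau> \<Longrightarrow> f \<in> D (\<tau> \<rightarrow>\<^sub>T TNat \<rightarrow>\<^sub>T \<tau>) \<Longrightarrow>
      ap (ap (ap (cn (Rc \<tau>)) (ap (cn Succ) n)) a) f =
      ap (ap f (ap (ap (ap (cn (Rc \<tau>)) n) a) f)) n"
    and Fst: "a \<in> D \<sigma> \<Longrightarrow> b \<in> D \<tau> \<Longrightarrow>
      ap (cn (Fstc \<sigma> \<tau>)) (ap (ap (cn (Pairc \<sigma> \<tau>)) a) b) = a"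
    and Snd: "a \<in> D \<sigma> \<Longrightarrow> b \<in> D \<tau> \<Longrightarrow>
      ap (cn (Sndc \<sigma> \<tau>)) (ap (ap (cn (Pairc \<sigma> \<tau>)) a) b) = b"
    and seq_exhaust: "w \<in> D (TSeq \<sigma>) \<Longrightarrow> w = cn (Nilc \<sigma>) \<or>
      (\<exists>a\<in>D \<sigma>. \<exists>v\<in>D (TSeq \<sigma>). w = ap (ap (cn (Consc \<sigma>)) a) v)"
    and L_Nil: "a \<in> D \<tau> \<Longrightarrow> f \<in> D (\<tau> \<rightarrow>\<^sub>T \<sigma> \<rightarrow>\<^sub>T \<tau>) \<Longrightarrow>
      ap (ap (ap (cn (Lc \<sigma> \<tau>)) (cn (Nilc \<sigma>))) a) f = a"
    and L_Cons: "b \<in> D \<sigma> \<Longrightarrow> v \<in> D (TSeq \<sigma>) \<Longrightarrow> a \<in> D \<tau> \<Longrightarrow> f \<in> D (\<tau> \<rightarrow>\<^sub>T \<sigma> \<rightarrow>\<^sub>T \<tau>) \<Longrightarrow>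
      ap (ap (ap (cn (Lc \<sigma> \<tau>)) (ap (ap (cn (Consc \<sigma>)) b) v)) a) f =
      ap (ap f (ap (ap (ap (cn (Lc \<sigma> \<tau>)) v) a) f)) b"

section \<open>The term model\<close>

locale henkin_set =
  fixes H :: "fm set"
  assumes henkin: "henkin H"
begin

section \<open>Membership in a Henkin set as classical truth\<close>

lemma closed: "finite F \<Longrightarrow> F \<subseteq> H \<Longrightarrow> F \<turnstile> \<phi> \<Longrightarrow> \<phi> \<in> H"
  using henkin unfolding henkin_def by blast

lemma mem_wff: "\<phi> \<in> H \<Longrightarrow> wff \<phi>"
  using henkin unfolding henkin_def by blast

lemma axm_mem: "axm \<phi> \<Longrightarrow> wff \<phi> \<Longrightarrow> \<phi> \<in> H"
  by (rule closed[of "{}"]) (auto intro: ax)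

lemma Fls_mem [simp]: "Fls \<notin> H"
  using henkin unfolding henkin_def by blast

lemma mem_hyp: "\<phi> \<in> H \<Longrightarrow> \<phi> \<in> F \<Longrightarrow> F \<turnstile> \<phi>"
  by (simp add: hyp mem_wff)

lemma mp: "(\<phi> \<^bold>\<longrightarrow> \<psi>) \<in> H \<Longrightarrow> \<phi> \<in> H \<Longrightarrow> \<psi> \<in> H"
  by (rule closed[of "{\<phi> \<^bold>\<longrightarrow> \<psi>, \<phi>}"]) (auto intro: impE mem_hyp)

lemma Neg_mem [simp]: "wff \<phi> \<Longrightarrow> Neg \<phi> \<in> H \<longleftrightarrow> \<phi> \<notin> H"
  using henkin mp[of \<phi> Fls] unfolding henkin_def by auto

lemma Imp_mem [simp]:
  assumes "wff \<phi>" "wff \<psi>"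
  shows "(\<phi> \<^bold>\<longrightarrow> \<psi>) \<in> H \<longleftrightarrow> (\<phi> \<in> H \<longrightarrow> \<psi> \<in> H)"
proof
  assume "\<phi> \<in> H \<longrightarrow> \<psi> \<in> H"
  then consider "Neg \<phi> \<in> H" | "\<psi> \<in> H" using assms by auto
  then show "(\<phi> \<^bold>\<longrightarrow> \<psi>) \<in> H"
  proof cases
    case 1
    show ?thesis
    proof (rule closed[of "{Neg \<phi>}"])
      have "insert \<phi> {Neg \<phi>} \<turnstile> Fls"
        by (rule impE[of _ \<phi>]; rule hyp) (use assms in auto)
      then show "{Neg \<phi>} \<turnstile> \<phi> \<^bold>\<longrightarrow> \<psi>"
        by (rule proves.impI[OF falseE]) (use assms in auto)
    qed (use 1 in auto)
  next
    case 2
    show ?thesis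
    proof (rule closed[of "{\<psi>}"])
      show "{\<psi>} \<turnstile> \<phi> \<^bold>\<longrightarrow> \<psi>"
        by (rule proves.impI, rule hyp) (use assms in auto)
    qed (use 2 in auto)
  qed
qed (auto dest: mp)

lemma Conj_mem [simp]: "(\<phi> \<^bold>\<and> \<psi>) \<in> H \<longleftrightarrow> \<phi> \<in> H \<and> \<psi> \<in> H"
proof
  assume "(\<phi> \<^bold>\<and> \<psi>) \<in> H"
  then have "{\<phi> \<^bold>\<and> \<psi>} \<turnstile> \<phi> \<^bold>\<and> \<psi>" "{\<phi> \<^bold>\<and> \<psi>} \<subseteq> H" by (auto intro: mem_hyp)
  then show "\<phi> \<in> H \<and> \<psi> \<in> H" by (meson closed conjE1 conjE2 finite.intros)
next
  assume "\<phi> \<in> H \<and> \<psi> \<in> H"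
  then show "(\<phi> \<^bold>\<and> \<psi>) \<in> H"
    by (intro closed[of "{\<phi>, \<psi>}"] proves.conjI) (auto intro: mem_hyp)
qed

lemma Disj_mem [simp]:
  assumes wf: "wff \<phi>" "wff \<psi>"
  shows "(\<phi> \<^bold>\<or> \<psi>) \<in> H \<longleftrightarrow> \<phi> \<in> H \<or> \<psi> \<in> H"
proof
  assume d: "(\<phi> \<^bold>\<or> \<psi>) \<in> H"
  show "\<phi> \<in> H \<or> \<psi> \<in> H"
  proof (rule ccontr)
    assume "\<not> (\<phi> \<in> H \<or> \<psi> \<in> H)"
    then have n: "Neg \<phi> \<in> H" "Neg \<psi> \<in> H" using wf by auto
    let ?F = "{\<phi> \<^bold>\<or> \<psi>, Neg \<phi>, Neg \<psi>}"
    have "?F \<turnstile> Fls"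
    proof (rule disjE[where \<phi> = \<phi> and \<psi> = \<psi>])
      show "insert \<phi> ?F \<turnstile> Fls"
        by (rule impE[of _ \<phi>]; rule hyp) (use wf in auto)
      show "insert \<psi> ?F \<turnstile> Fls"
        by (rule impE[of _ \<psi>]; rule hyp) (use wf in auto)
    qed (use wf in \<open>auto intro: hyp\<close>)
    then have "Fls \<in> H" using n d by (intro closed[of ?F]) auto
    then show False by simp
  qed
next
  assume "\<phi> \<in> H \<or> \<psi> \<in> H"
  then show "(\<phi> \<^bold>\<or> \<psi>) \<in> H"
  proof
    assume "\<phi> \<in> H"
    then show ?thesis
      using wf by (intro closed[of "{\<phi>}"] proves.disjI1) (auto intro: hyp)
  next
    assume "\<psi> \<in> H"
    then show ?thesis
      using wf by (intro closed[of "{\<psi>}"] proves.disjI2) (auto intro: hyp)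
  qed
qed

text \<open>Terms over witness variables play the role of closed terms: they name the elements of
  the model and can be substituted without capture into formulas whose bound variables avoid
  \<open>W\<close>.\<close>

definition trm :: "ty \<Rightarrow> tm set" where
  "trm \<tau> = {t. vars t \<subseteq> W \<and> tyof t = Some \<tau>}"

lemma Con_trm [simp]: "Con c \<in> trm (cst_ty c)"
  by (simp add: trm_def)

lemma App_trm [intro]: "t \<in> trm (\<sigma> \<rightarrow>\<^sub>T \<tau>) \<Longrightarrow> u \<in> trm \<sigma> \<Longrightarrow> t \<cdot> u \<in> trm \<tau>"
  by (simp add: trm_def)

lemma Forall_instance:
  assumes "Forall x \<phi> \<in> H" "bvs \<phi> \<inter> W = {}" "s \<in> trm (snd x)"
  shows "fsubst x s \<phi> \<in> H"
proof (rule closed[of "{Forall x \<phi>}"])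
  show "{Forall x \<phi>} \<turnstile> fsubst x s \<phi>"
    using assms by (intro allE mem_hyp free_for_disjoint) (auto simp: trm_def)
qed (use assms in auto)

text \<open>From left to right the Henkin witness is the required term; from right to left this is
  \<open>exI\<close>, with capture excluded by disjointness from \<open>W\<close>.\<close>

lemma Exists_mem:
  assumes "wff \<phi>" "bvs \<phi> \<inter> W = {}"
  shows "Exists x \<phi> \<in> H \<longleftrightarrow> (\<exists>s\<in>trm (snd x). fsubst x s \<phi> \<in> H)"
proof
  assume "Exists x \<phi> \<in> H"
  then obtain w where "w \<in> W" "snd w = snd x" "fsubst x (Var w) \<phi> \<in> H"
    using henkin unfolding henkin_def by blast
  then show "\<exists>s\<in>trm (snd x). fsubst x s \<phi> \<in> H"
    by (intro bexI[of _ "Var w"]) (auto simp: trm_def)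
next
  assume "\<exists>s\<in>trm (snd x). fsubst x s \<phi> \<in> H"
  then obtain s where s: "s \<in> trm (snd x)" "fsubst x s \<phi> \<in> H" by blast
  show "Exists x \<phi> \<in> H"
  proof (rule closed[of "{fsubst x s \<phi>}"])
    show "{fsubst x s \<phi>} \<turnstile> Exists x \<phi>"
      using s assms by (intro exI[of _ _ s] mem_hyp free_for_disjoint) (auto simp: trm_def)
  qed (use s in auto)
qed

text \<open>A universal formula missing from \<open>H\<close> yields, by duality, a term whose
  instance is negated in \<open>H\<close>.\<close>

lemma Forall_mem:
  assumes "wff \<phi>" "bvs \<phi> \<inter> W = {}"
  shows "Forall x \<phi> \<in> H \<longleftrightarrow> (\<forall>s\<in>trm (snd x). fsubst x s \<phi> \<in> H)"
proof (intro iffI ballI)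
  assume *: "\<forall>s\<in>trm (snd x). fsubst x s \<phi> \<in> H"
  show "Forall x \<phi> \<in> H"
  proof (rule ccontr)
    assume "Forall x \<phi> \<notin> H"
    then have "Neg (Forall x \<phi>) \<in> H" using assms by simp
    then have "Exists x (Neg \<phi>) \<in> H"
      using not_forall[OF assms(1)] by (intro closed[of "{Neg (Forall x \<phi>)}"]) auto
    then obtain s where s: "s \<in> trm (snd x)" "fsubst x s (Neg \<phi>) \<in> H"
      using Exists_mem[of "Neg \<phi>" x] assms by auto
    moreover have "wff (fsubst x s \<phi>)" using s(1) assms by (simp add: trm_def)
    ultimately have "fsubst x s \<phi> \<notin> H" by simp
    with * s show False by blast
  qed
qed (use Forall_instance assms in blast)

lemma fresh_trm: "t \<in> trm \<tau> \<Longrightarrow> x \<notin> W \<Longrightarrow> x \<notin> vars t"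
  by (auto simp: trm_def)

section \<open>Equality in the Henkin set as a congruence, and the quotient of the terms\<close>

lemma Eq_refl: "t \<in> trm \<tau> \<Longrightarrow> (t \<^bold>= t) \<in> H"
  by (intro axm_mem axm.eq_refl) (auto simp: trm_def)

lemma Eq_replace:
  assumes "(t \<^bold>= u) \<in> H" "t \<in> trm (snd x)" "u \<in> trm (snd x)" "wff \<phi>" "bvs \<phi> = {}"
    "fsubst x t \<phi> \<in> H"
  shows "fsubst x u \<phi> \<in> H"
proof -
  have "(t \<^bold>= u \<^bold>\<longrightarrow> fsubst x t \<phi> \<^bold>\<longrightarrow> fsubst x u \<phi>) \<in> H"
    using assms by (intro axm_mem axm.eq_subst free_for_disjoint) (auto simp: trm_def)
  then show ?thesis using assms mp by blast
qed

lemma Eq_sym: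
  assumes "(t \<^bold>= u) \<in> H" "t \<in> trm \<tau>" "u \<in> trm \<tau>"
  shows "(u \<^bold>= t) \<in> H"
proof -
  \<comment> \<open>The empty name has fewer than six letters, so this placeholder is outside
    \<open>W\<close> and occurs in no term of \<open>trm\<close>.\<close>
  let ?x = "('''', \<tau>)"
  have "?x \<notin> vars t" using assms by (intro fresh_trm) (auto simp: W_def)
  with assms show ?thesis
    using Eq_replace[of t u ?x "Var ?x \<^bold>= t"] Eq_refl[of t] by (auto simp: trm_def)
qed

lemma Eq_trans:
  assumes "(t \<^bold>= u) \<in> H" "(u \<^bold>= v) \<in> H" "t \<in> trm \<tau>" "u \<in> trm \<tau>" "v \<in> trm \<tau>"
  shows "(t \<^bold>= v) \<in> H"
proof -
  let ?x = "('''', \<tau>)"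
  have "?x \<notin> vars t" using assms by (intro fresh_trm) (auto simp: W_def)
  with assms show ?thesis
    using Eq_replace[of u v ?x "t \<^bold>= Var ?x"] by (auto simp: trm_def)
qed

lemma Eq_App:
  assumes "(t \<^bold>= t') \<in> H" "(u \<^bold>= u') \<in> H"
    "t \<in> trm (\<sigma> \<rightarrow>\<^sub>T \<tau>)" "t' \<in> trm (\<sigma> \<rightarrow>\<^sub>T \<tau>)" "u \<in> trm \<sigma>" "u' \<in> trm \<sigma>"
  shows "(t \<cdot> u \<^bold>= t' \<cdot> u') \<in> H"
proof -
  let ?x = "('''', \<sigma> \<rightarrow>\<^sub>T \<tau>)" and ?y = "('''', \<sigma>)"
  have fresh: "?x \<notin> vars t" "?x \<notin> vars u" "?y \<notin> vars t" "?y \<notin> vars t'" "?y \<notin> vars u"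
    using fresh_trm assms by (auto simp: W_def)
  have "(t \<cdot> u \<^bold>= t \<cdot> u) \<in> H" using assms Eq_refl by blast
  then have "(t \<cdot> u \<^bold>= t' \<cdot> u) \<in> H"
    using Eq_replace[of t t' ?x "t \<cdot> u \<^bold>= Var ?x \<cdot> u"] assms fresh by (auto simp: trm_def)
  then show ?thesis
    using Eq_replace[of u u' ?y "t \<cdot> u \<^bold>= t' \<cdot> Var ?y"] assms fresh by (auto simp: trm_def)
qed

definition cls :: "tm \<Rightarrow> tm set" where
  "cls t = {u. vars u \<subseteq> W \<and> tyof u = tyof t \<and> (t \<^bold>= u) \<in> H}"

text \<open>Application and assignments are pulled back to terms through representatives; congruence
  makes the choice immaterial.\<close>

definition rep :: "tm set \<Rightarrow> tm" where
  "rep a = (SOME t. t \<in> a)"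

definition dom :: "ty \<Rightarrow> tm set set" where
  "dom \<tau> = cls ` trm \<tau>"

definition app :: "tm set \<Rightarrow> tm set \<Rightarrow> tm set" where
  "app a b = cls (rep a \<cdot> rep b)"

definition cnst :: "cst \<Rightarrow> tm set" where
  "cnst c = cls (Con c)"

lemma cls_self: "t \<in> trm \<tau> \<Longrightarrow> t \<in> cls t"
  using Eq_refl by (auto simp: cls_def trm_def)

lemma cls_eq:
  assumes "t \<in> trm \<tau>" "u \<in> trm \<tau>"
  shows "cls t = cls u \<longleftrightarrow> (t \<^bold>= u) \<in> H"
proof
  assume "cls t = cls u"
  then have "u \<in> cls t" using cls_self assms by blast
  then show "(t \<^bold>= u) \<in> H" by (simp add: cls_def)
next
  assume *: "(t \<^bold>= u) \<in> H"
  have "(t \<^bold>= v) \<in> H \<longleftrightarrow> (u \<^bold>= v) \<in> H" if "v \<in> trm \<tau>" for v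
    using Eq_trans[of t u v] Eq_trans[of u t v] Eq_sym[of t u] * that assms by blast
  with assms show "cls t = cls u" by (auto simp: cls_def trm_def)
qed

lemma cls_dom [intro]: "t \<in> trm \<tau> \<Longrightarrow> cls t \<in> dom \<tau>"
  by (simp add: dom_def)

lemma rep_cls:
  assumes "t \<in> trm \<tau>"
  shows "rep (cls t) \<in> trm \<tau>" "(t \<^bold>= rep (cls t)) \<in> H"
proof -
  have "rep (cls t) \<in> cls t"
    unfolding rep_def using cls_self[OF assms] by (rule someI)
  with assms show "rep (cls t) \<in> trm \<tau>" "(t \<^bold>= rep (cls t)) \<in> H"
    by (auto simp: cls_def trm_def)
qed

lemma rep_trm: "a \<in> dom \<tau> \<Longrightarrow> rep a \<in> trm \<tau>"
  using rep_cls by (auto simp: dom_def)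

lemma cls_rep:
  assumes "a \<in> dom \<tau>"
  shows "cls (rep a) = a"
proof -
  obtain t where t: "t \<in> trm \<tau>" "a = cls t" using assms by (auto simp: dom_def)
  then have "cls t = cls (rep a)" using cls_eq rep_cls by blast
  with t show ?thesis by simp
qed

lemma app_cls:
  assumes "t \<in> trm (\<sigma> \<rightarrow>\<^sub>T \<tau>)" "u \<in> trm \<sigma>"
  shows "app (cls t) (cls u) = cls (t \<cdot> u)"
proof -
  have "(t \<cdot> u \<^bold>= rep (cls t) \<cdot> rep (cls u)) \<in> H"
    using assms rep_cls by (intro Eq_App) blast+
  moreover have "t \<cdot> u \<in> trm \<tau>" "rep (cls t) \<cdot> rep (cls u) \<in> trm \<tau>"
    using assms rep_cls by blast+
  ultimately show ?thesis unfolding app_def using cls_eq by blast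
qed

sublocale tm: interp dom app cnst .

section \<open>Assignments as substitutions, and the truth lemma\<close>

definition wenv :: "(var \<Rightarrow> tm) \<Rightarrow> bool" where
  "wenv \<theta> \<longleftrightarrow> (\<forall>z. \<theta> z \<in> trm (snd z))"

lemma wenv_upd [simp]: "wenv \<theta> \<Longrightarrow> s \<in> trm (snd x) \<Longrightarrow> wenv (\<theta>(x := s))"
  by (simp add: wenv_def)

lemma tyof_wenv: "wenv \<theta> \<Longrightarrow> tyof (tsub \<theta> t) = tyof t"
  by (simp add: wenv_def trm_def)

lemma tsub_trm: "wenv \<theta> \<Longrightarrow> tyof t = Some \<tau> \<Longrightarrow> tsub \<theta> t \<in> trm \<tau>"
  using tyof_wenv[of \<theta> t] by (auto simp: wenv_def trm_def vars_tsub)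

lemma wff_bind:
  assumes "wenv \<theta>"
  shows "wff (ssub (\<theta>(x := Var x)) \<phi>) = wff \<phi>"
  using assms by (intro wff_ssub) (simp add: wenv_def trm_def)

lemma wff_wenv: "wenv \<theta> \<Longrightarrow> wff (ssub \<theta> \<phi>) = wff \<phi>"
  by (simp add: wenv_def trm_def)

lemma fsubst_bind:
  assumes "wenv \<theta>" "x \<notin> W"
  shows "fsubst x s (ssub (\<theta>(x := u)) \<phi>) = ssub (\<theta>(x := tsubst x s u)) \<phi>"
proof -
  have "x \<notin> vars (\<theta> z)" for z
    using assms fresh_trm unfolding wenv_def by blast
  then show ?thesis by (subst fsubst_ssub) auto
qed

lemma ev_cls:
  assumes "wenv \<theta>" "tyof t = Some \<tau>"
  shows "tm.ev (cls \<circ> \<theta>) t = cls (tsub \<theta> t)"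
  using assms(2)
proof (induction t arbitrary: \<tau>)
  case (App t u)
  obtain \<sigma> where \<sigma>: "tyof t = Some (\<sigma> \<rightarrow>\<^sub>T \<tau>)" "tyof u = Some \<sigma>"
    using App.prems by (rule tyof_AppE)
  with App.IH show ?case
    using app_cls[OF tsub_trm[OF assms(1) \<sigma>(1)] tsub_trm[OF assms(1) \<sigma>(2)]] by simp
qed (simp_all add: cnst_def)

text \<open>Every element of a domain is the class of a term, so quantification over elements turns
  into quantification over term instances, which \<open>Forall_mem\<close> and
  \<open>Exists_mem\<close> settle. The substitution varies in the induction because each binder
  updates it.\<close>

lemma truth:
  assumes "wenv \<theta>" "wff \<phi>" "bvs \<phi> \<inter> W = {}"
  shows "tm.sat (cls \<circ> \<theta>) \<phi> \<longleftrightarrow> ssub \<theta> \<phi> \<in> H"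
  using assms
proof (induction \<phi> arbitrary: \<theta>)
  case (Eq t u)
  then obtain \<tau> where "tyof t = Some \<tau>" "tyof u = Some \<tau>" by (cases "tyof t") auto
  with Eq show ?case
    using cls_eq[OF tsub_trm[of \<theta> t] tsub_trm[of \<theta> u]] by (simp add: ev_cls del: o_apply)
next
  case (Forall x \<phi>)
  have upd: "(cls \<circ> \<theta>)(x := cls s) = (cls \<circ> \<theta>(x := s))" for s
    by (rule HOL.ext) simp
  have x: "x \<notin> W" using Forall.prems by auto
  have IH: "tm.sat (cls \<circ> \<theta>(x := s)) \<phi> \<longleftrightarrow> ssub (\<theta>(x := s)) \<phi> \<in> H"
    if "s \<in> trm (snd x)" for s
    by (rule Forall.IH) (use Forall.prems that in \<open>auto simp del: fun_upd_apply\<close>)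
  have "tm.sat (cls \<circ> \<theta>) (Forall x \<phi>) \<longleftrightarrow>
      (\<forall>s\<in>trm (snd x). tm.sat (cls \<circ> \<theta>(x := s)) \<phi>)"
    unfolding tm.sat.simps dom_def ball_simps upd ..
  also have "\<dots> \<longleftrightarrow> (\<forall>s\<in>trm (snd x). ssub (\<theta>(x := s)) \<phi> \<in> H)"
    using IH by (intro ball_cong refl) blast
  also have "\<dots> \<longleftrightarrow> ssub \<theta> (Forall x \<phi>) \<in> H"
    using Forall.prems x by (simp add: Forall_mem wff_bind fsubst_bind)
  finally show ?case .
next
  case (Exists x \<phi>)
  have upd: "(cls \<circ> \<theta>)(x := cls s) = (cls \<circ> \<theta>(x := s))" for s
    by (rule HOL.ext) simp
  have x: "x \<notin> W" using Exists.prems by auto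
  have IH: "tm.sat (cls \<circ> \<theta>(x := s)) \<phi> \<longleftrightarrow> ssub (\<theta>(x := s)) \<phi> \<in> H"
    if "s \<in> trm (snd x)" for s
    by (rule Exists.IH) (use Exists.prems that in \<open>auto simp del: fun_upd_apply\<close>)
  have "tm.sat (cls \<circ> \<theta>) (Exists x \<phi>) \<longleftrightarrow>
      (\<exists>s\<in>trm (snd x). tm.sat (cls \<circ> \<theta>(x := s)) \<phi>)"
    unfolding tm.sat.simps dom_def bex_simps upd ..
  also have "\<dots> \<longleftrightarrow> (\<exists>s\<in>trm (snd x). ssub (\<theta>(x := s)) \<phi> \<in> H)"
    using IH by (intro bex_cong refl) blast
  also have "\<dots> \<longleftrightarrow> ssub \<theta> (Exists x \<phi>) \<in> H"
    using Exists.prems x by (simp add: Exists_mem wff_bind fsubst_bind)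
  finally show ?case .
qed (simp_all add: wff_wenv Int_Un_distrib2)

section \<open>The quotient satisfies the axioms\<close>

lemma domE:
  assumes "a \<in> dom \<tau>"
  obtains t where "t \<in> trm \<tau>" "a = cls t"
  using assms by (auto simp: dom_def)

lemma axm_cls:
  assumes "axm (t \<^bold>= u)" "vars t \<subseteq> W" "vars u \<subseteq> W" "tyof t \<noteq> None" "tyof u = tyof t"
  shows "cls t = cls u"
proof -
  obtain \<tau> where "tyof t = Some \<tau>" using assms(4) by blast
  with assms show ?thesis by (subst cls_eq[of _ \<tau>]) (auto simp: trm_def intro: axm_mem)
qed

lemmas cls_axms =
  axm.K[THEN axm_cls] axm.S[THEN axm_cls] axm.R_zero[THEN axm_cls] axm.R_succ[THEN axm_cls]
  axm.fst_pair[THEN axm_cls] axm.snd_pair[THEN axm_cls]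
  axm.L_nil[THEN axm_cls] axm.L_cons[THEN axm_cls]

lemma Con_trm': "cst_ty c = \<tau> \<Longrightarrow> Con c \<in> trm \<tau>"
  by auto

text \<open>Agreement on all classes puts every instance of the premise of the extensionality axiom
  into \<open>H\<close>, and \<open>Forall_mem\<close> then gives the premise itself.\<close>

lemma term_fun_ext:
  assumes "t \<in> trm (\<sigma> \<rightarrow>\<^sub>T \<tau>)" "u \<in> trm (\<sigma> \<rightarrow>\<^sub>T \<tau>)"
    and eq: "\<And>s. s \<in> trm \<sigma> \<Longrightarrow> cls (t \<cdot> s) = cls (u \<cdot> s)"
  shows "cls t = cls u"
proof -
  let ?x = "('''', \<sigma>)"
  have x: "?x \<notin> vars t" "?x \<notin> vars u"
    using fresh_trm assms by (auto simp: W_def)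
  have "(t \<cdot> s \<^bold>= u \<cdot> s) \<in> H" if "s \<in> trm \<sigma>" for s
    using eq[OF that] that assms by (subst (asm) cls_eq[of _ \<tau>]) auto
  then have "Forall ?x (t \<cdot> Var ?x \<^bold>= u \<cdot> Var ?x) \<in> H"
    using x assms by (subst Forall_mem) (auto simp: trm_def)
  moreover have "(Forall ?x (t \<cdot> Var ?x \<^bold>= u \<cdot> Var ?x) \<^bold>\<longrightarrow> t \<^bold>= u) \<in> H"
    using x assms by (intro axm_mem axm.ext) (auto simp: trm_def)
  ultimately show ?thesis using assms mp cls_eq by blast
qed

text \<open>A property defined with parameters from the model is also defined by a single formula,
  since the parameters are named by terms. The induction axiom for that formula lies in
  \<open>H\<close>.\<close>

lemma term_induct:
  assumes x: "snd x = TNat" "x \<notin> W" and \<phi>: "bvs \<phi> \<inter> W = {}" "wff \<phi>" and \<rho>: "tm.env \<rho>"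
    and zero: "tm.sat (\<rho>(x := cnst Zero)) \<phi>"
    and suc: "\<And>a. a \<in> dom TNat \<Longrightarrow> tm.sat (\<rho>(x := a)) \<phi> \<Longrightarrow>
      tm.sat (\<rho>(x := app (cnst Succ) a)) \<phi>"
    and b: "b \<in> dom TNat"
  shows "tm.sat (\<rho>(x := b)) \<phi>"
proof -
  define \<theta> where "\<theta> z = rep (\<rho> z)" for z
  have \<theta>: "wenv \<theta>" using \<rho> by (simp add: wenv_def \<theta>_def tm.env_def rep_trm)
  have \<rho>\<theta>: "\<rho> = (cls \<circ> \<theta>)"
  proof (rule HOL.ext)
    fix z
    have "\<rho> z \<in> dom (snd z)" using \<rho> by (simp add: tm.env_def)
    then show "\<rho> z = (cls \<circ> \<theta>) z" by (simp add: \<theta>_def cls_rep)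
  qed
  have upd: "\<rho>(x := cls s) = (cls \<circ> \<theta>(x := s))" for s
    unfolding \<rho>\<theta> by (rule HOL.ext) simp
  have sat: "tm.sat (\<rho>(x := cls s)) \<phi> \<longleftrightarrow> ssub (\<theta>(x := s)) \<phi> \<in> H" if "s \<in> trm TNat" for s
    unfolding upd using \<theta> x \<phi> that by (intro truth) auto
  \<comment> \<open>Representatives replace the parameters while \<open>x\<close> stays free, which
    is the formula the induction axiom is applied to.\<close>
  let ?\<psi> = "ssub (\<theta>(x := Var x)) \<phi>"
  have wf: "wff ?\<psi>" using \<theta> \<phi> by (simp add: wff_bind)
  have bv: "bvs ?\<psi> \<inter> W = {}" using \<phi> by simp
  have z: "Con Zero \<in> trm TNat" by (intro Con_trm') simp
  have S: "Con Succ \<cdot> s \<in> trm TNat" "cls (Con Succ \<cdot> s) = app (cnst Succ) (cls s)"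
    if "s \<in> trm TNat" for s
    using that app_cls[OF Con_trm'[of Succ]] App_trm[OF Con_trm'[of Succ]] by (auto simp: cnst_def)
  have "fsubst x (Con Zero) ?\<psi> \<in> H"
    using zero sat[OF z] \<theta> x by (simp add: fsubst_bind cnst_def)
  moreover have "Forall x (?\<psi> \<^bold>\<longrightarrow> fsubst x (Con Succ \<cdot> Var x) ?\<psi>) \<in> H"
  proof (subst Forall_mem)
    show "\<forall>s\<in>trm (snd x). fsubst x s (?\<psi> \<^bold>\<longrightarrow> fsubst x (Con Succ \<cdot> Var x) ?\<psi>) \<in> H"
    proof
      fix s assume "s \<in> trm (snd x)"
      then have s: "s \<in> trm TNat" using x by simp
      have "fsubst x s ?\<psi> \<in> H \<longrightarrow> fsubst x (Con Succ \<cdot> s) ?\<psi> \<in> H"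
        using suc[of "cls s"] s sat[OF s] sat[OF S(1)[OF s]] S(2)[OF s] \<theta> x
        by (auto simp: fsubst_bind)
      moreover have "fsubst x s (fsubst x (Con Succ \<cdot> Var x) ?\<psi>) = fsubst x (Con Succ \<cdot> s) ?\<psi>"
        using \<theta> x by (simp add: fsubst_bind)
      moreover have "wff (fsubst x s ?\<psi>)" "wff (fsubst x (Con Succ \<cdot> s) ?\<psi>)"
        using s x wf S(1)[OF s] by (simp_all add: trm_def)
      ultimately show "fsubst x s (?\<psi> \<^bold>\<longrightarrow> fsubst x (Con Succ \<cdot> Var x) ?\<psi>) \<in> H" by simp
    qed
  qed (use wf bv x in auto)
  moreover have "(fsubst x (Con Zero) ?\<psi> \<^bold>\<longrightarrow>
      Forall x (?\<psi> \<^bold>\<longrightarrow> fsubst x (Con Succ \<cdot> Var x) ?\<psi>) \<^bold>\<longrightarrow> Forall x ?\<psi>) \<in> H"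
    using x wf by (intro axm_mem axm.induction) auto
  ultimately have "Forall x ?\<psi> \<in> H" using mp by blast
  moreover obtain s where s: "s \<in> trm TNat" "b = cls s" using b by (rule domE)
  ultimately have "fsubst x s ?\<psi> \<in> H" using bv x by (intro Forall_instance) auto
  with s sat[OF s(1)] \<theta> x show ?thesis by (simp add: fsubst_bind)
qed

text \<open>The axiom nests two existential quantifiers; the term for the head is extracted from the
  outer one before the inner one can yield the tail.\<close>

lemma term_seq_exhaust:
  assumes "t \<in> trm (TSeq \<sigma>)"
  shows "cls t = cls (Con (Nilc \<sigma>)) \<or>
    (\<exists>a\<in>trm \<sigma>. \<exists>v\<in>trm (TSeq \<sigma>). cls t = cls (Con (Consc \<sigma>) \<cdot> a \<cdot> v))"
proof -
  define w where "w = (''w'', TSeq \<sigma>)"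
  define a where "a = (''a'', \<sigma>)"
  define v where "v = (''v'', TSeq \<sigma>)"
  let ?\<phi> = "Var w \<^bold>= Con (Nilc \<sigma>) \<^bold>\<or>
    Exists a (Exists v (Var w \<^bold>= Con (Consc \<sigma>) \<cdot> Var a \<cdot> Var v))"
  have nW: "w \<notin> W" "a \<notin> W" "v \<notin> W" and neq: "w \<noteq> a" "w \<noteq> v" "v \<noteq> a" "a \<noteq> w" "v \<noteq> w" "a \<noteq> v"
    and ty: "snd w = TSeq \<sigma>" "snd a = \<sigma>" "snd v = TSeq \<sigma>"
    by (simp_all add: W_def w_def a_def v_def)
  have "axm (Forall w ?\<phi>)" by (rule axm.seq_cases) (simp_all add: w_def a_def v_def)
  then have "Forall w ?\<phi> \<in> H" using ty by (intro axm_mem) simp_all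
  then have "fsubst w t ?\<phi> \<in> H" using nW assms ty by (intro Forall_instance) auto
  then have "(t \<^bold>= Con (Nilc \<sigma>) \<^bold>\<or>
      Exists a (Exists v (t \<^bold>= Con (Consc \<sigma>) \<cdot> Var a \<cdot> Var v))) \<in> H"
    using neq by simp
  moreover have "wff (t \<^bold>= Con (Nilc \<sigma>))"
    "wff (Exists a (Exists v (t \<^bold>= Con (Consc \<sigma>) \<cdot> Var a \<cdot> Var v)))"
    using assms ty by (simp_all add: trm_def)
  ultimately consider "(t \<^bold>= Con (Nilc \<sigma>)) \<in> H"
    | "Exists a (Exists v (t \<^bold>= Con (Consc \<sigma>) \<cdot> Var a \<cdot> Var v)) \<in> H"
    using Disj_mem by blast
  then show ?thesis
  proof cases
    case 1
    then have "cls t = cls (Con (Nilc \<sigma>))"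
      using cls_eq[OF assms Con_trm'[of "Nilc \<sigma>"]] by simp
    then show ?thesis ..
  next
    case 2
    have vt: "v \<notin> vars t" "a \<notin> vars t" using fresh_trm[OF assms] nW by auto
    let ?\<chi> = "\<lambda>s. t \<^bold>= Con (Consc \<sigma>) \<cdot> s \<cdot> Var v"
    have wf: "wff (?\<chi> s)" if "tyof s = Some \<sigma>" for s
      using assms ty that by (simp add: trm_def)
    have "\<exists>s\<in>trm (snd a). fsubst a s (Exists v (?\<chi> (Var a))) \<in> H"
      by (rule iffD1[OF Exists_mem 2]) (use wf[of "Var a"] ty nW in simp_all)
    then obtain s where s: "s \<in> trm (snd a)" "fsubst a s (Exists v (?\<chi> (Var a))) \<in> H"
      by (rule bexE)
    moreover have "fsubst a s (Exists v (?\<chi> (Var a))) = Exists v (?\<chi> s)"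
      using neq vt by simp
    ultimately have s: "s \<in> trm \<sigma>" "Exists v (?\<chi> s) \<in> H" using ty by simp_all
    have vs: "v \<notin> vars s" using fresh_trm[OF s(1)] nW by auto
    have "\<exists>r\<in>trm (snd v). fsubst v r (?\<chi> s) \<in> H"
      by (rule iffD1[OF Exists_mem s(2)]) (use wf[of s] s ty in \<open>simp_all add: trm_def\<close>)
    then obtain r where r: "r \<in> trm (snd v)" "fsubst v r (?\<chi> s) \<in> H"
      by (rule bexE)
    moreover have "fsubst v r (?\<chi> s) = (t \<^bold>= Con (Consc \<sigma>) \<cdot> s \<cdot> r)"
      using vt vs by simp
    ultimately have r: "r \<in> trm (TSeq \<sigma>)" "(t \<^bold>= Con (Consc \<sigma>) \<cdot> s \<cdot> r) \<in> H"
      using ty by simp_all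
    have "Con (Consc \<sigma>) \<cdot> s \<cdot> r \<in> trm (TSeq \<sigma>)"
      using s r by (simp add: trm_def)
    then have "cls t = cls (Con (Consc \<sigma>) \<cdot> s \<cdot> r)" using r(2) assms cls_eq by simp
    with s r(1) show ?thesis by blast
  qed
qed

lemma app_dom: "f \<in> dom (\<sigma> \<rightarrow>\<^sub>T \<tau>) \<Longrightarrow> a \<in> dom \<sigma> \<Longrightarrow> app f a \<in> dom \<tau>"
  using app_cls cls_dom[OF App_trm] by (elim domE) simp

lemma app_cls_typed:
  assumes "vars t \<subseteq> W" "vars u \<subseteq> W" "tyof (t \<cdot> u) \<noteq> None"
  shows "app (cls t) (cls u) = cls (t \<cdot> u)"
proof -
  obtain \<tau> where "tyof (t \<cdot> u) = Some \<tau>" using assms(3) by blast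
  then obtain \<sigma> where "tyof t = Some (\<sigma> \<rightarrow>\<^sub>T \<tau>)" "tyof u = Some \<sigma>" by (rule tyof_AppE)
  with assms show ?thesis by (intro app_cls) (auto simp: trm_def)
qed

sublocale tm: model dom app cnst
proof
  show "cnst c \<in> dom (cst_ty c)" for c
    unfolding cnst_def by (intro cls_dom Con_trm)
  show "app f a \<in> dom \<tau>" if "f \<in> dom (\<sigma> \<rightarrow>\<^sub>T \<tau>)" "a \<in> dom \<sigma>" for f \<sigma> \<tau> a
    using that by (rule app_dom)
  show "f = g" if fg: "f \<in> dom (\<sigma> \<rightarrow>\<^sub>T \<tau>)" "g \<in> dom (\<sigma> \<rightarrow>\<^sub>T \<tau>)"
    "\<And>a. a \<in> dom \<sigma> \<Longrightarrow> app f a = app g a" for f g \<sigma> \<tau>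
  proof -
    obtain t u where "t \<in> trm (\<sigma> \<rightarrow>\<^sub>T \<tau>)" "f = cls t" "u \<in> trm (\<sigma> \<rightarrow>\<^sub>T \<tau>)" "g = cls u"
      using fg(1,2) by (auto elim!: domE)
    moreover from this have "cls (t \<cdot> s) = cls (u \<cdot> s)" if "s \<in> trm \<sigma>" for s
      using fg(3)[of "cls s"] that app_cls[of t \<sigma> \<tau> s] app_cls[of u \<sigma> \<tau> s] by (simp add: cls_dom)
    ultimately show "f = g" using term_fun_ext by blast
  qed
  show "app (cnst Succ) a \<noteq> cnst Zero" if a: "a \<in> dom TNat" for a
  proof -
    obtain t where t: "t \<in> trm TNat" "a = cls t" using a by (rule domE)
    then have "(Con Succ \<cdot> t \<^bold>= Con Zero) \<notin> H"
      using axm_mem[OF axm.succ_not_zero[of t]] by (simp add: trm_def)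
    with t show ?thesis
      unfolding cnst_def by (simp add: app_cls_typed trm_def cls_eq[of _ TNat])
  qed
  show "a = b" if ab: "a \<in> dom TNat" "b \<in> dom TNat" "app (cnst Succ) a = app (cnst Succ) b" for a b
  proof -
    obtain t u where t: "t \<in> trm TNat" "a = cls t" "u \<in> trm TNat" "b = cls u"
      using ab(1,2) by (auto elim!: domE)
    with ab(3) show ?thesis
      using axm_mem[OF axm.succ_inject[of t u]]
      unfolding cnst_def by (simp add: app_cls_typed trm_def cls_eq[of _ TNat])
  qed
  show "app (app (cnst (Kc \<sigma> \<tau>)) a) b = a" if "a \<in> dom \<sigma>" "b \<in> dom \<tau>" for a b \<sigma> \<tau>
    using that by (auto elim!: domE simp: cnst_def app_cls_typed trm_def cls_axms)
  show "app (app (app (cnst (Sc \<sigma> \<tau> \<upsilon>)) a) b) c = app (app a c) (app b c)"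
    if "a \<in> dom (\<sigma> \<rightarrow>\<^sub>T \<tau> \<rightarrow>\<^sub>T \<upsilon>)" "b \<in> dom (\<sigma> \<rightarrow>\<^sub>T \<tau>)" "c \<in> dom \<sigma>" for a b c \<sigma> \<tau> \<upsilon>
    using that by (auto elim!: domE simp: cnst_def app_cls_typed trm_def cls_axms)
  show "app (app (app (cnst (Rc \<tau>)) (cnst Zero)) a) f = a"
    if "a \<in> dom \<tau>" "f \<in> dom (\<tau> \<rightarrow>\<^sub>T TNat \<rightarrow>\<^sub>T \<tau>)" for a f \<tau>
    using that by (auto elim!: domE simp: cnst_def app_cls_typed trm_def cls_axms)
  show "app (app (app (cnst (Rc \<tau>)) (app (cnst Succ) n)) a) f =
      app (app f (app (app (app (cnst (Rc \<tau>)) n) a) f)) n"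
    if "n \<in> dom TNat" "a \<in> dom \<tau>" "f \<in> dom (\<tau> \<rightarrow>\<^sub>T TNat \<rightarrow>\<^sub>T \<tau>)" for n a f \<tau>
    using that by (auto elim!: domE simp: cnst_def app_cls_typed trm_def cls_axms)
  show "app (cnst (Fstc \<sigma> \<tau>)) (app (app (cnst (Pairc \<sigma> \<tau>)) a) b) = a"
    if "a \<in> dom \<sigma>" "b \<in> dom \<tau>" for a b \<sigma> \<tau>
    using that by (auto elim!: domE simp: cnst_def app_cls_typed trm_def cls_axms)
  show "app (cnst (Sndc \<sigma> \<tau>)) (app (app (cnst (Pairc \<sigma> \<tau>)) a) b) = b"
    if "a \<in> dom \<sigma>" "b \<in> dom \<tau>" for a b \<sigma> \<tau>
    using that by (auto elim!: domE simp: cnst_def app_cls_typed trm_def cls_axms)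
  show "w = cnst (Nilc \<sigma>) \<or>
      (\<exists>a\<in>dom \<sigma>. \<exists>v\<in>dom (TSeq \<sigma>). w = app (app (cnst (Consc \<sigma>)) a) v)"
    if w: "w \<in> dom (TSeq \<sigma>)" for w \<sigma>
  proof -
    obtain t where "t \<in> trm (TSeq \<sigma>)" "w = cls t" using w by (rule domE)
    then consider "w = cnst (Nilc \<sigma>)"
      | a v where "a \<in> trm \<sigma>" "v \<in> trm (TSeq \<sigma>)" "w = cls (Con (Consc \<sigma>) \<cdot> a \<cdot> v)"
      using term_seq_exhaust unfolding cnst_def by blast
    moreover have "cls (Con (Consc \<sigma>) \<cdot> a \<cdot> v) = app (app (cnst (Consc \<sigma>)) (cls a)) (cls v)"
      if "a \<in> trm \<sigma>" "v \<in> trm (TSeq \<sigma>)" for a v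
      using that by (simp add: cnst_def app_cls_typed trm_def)
    ultimately show ?thesis
      by cases (use cls_dom in blast)+
  qed
  show "app (app (app (cnst (Lc \<sigma> \<tau>)) (cnst (Nilc \<sigma>))) a) f = a"
    if "a \<in> dom \<tau>" "f \<in> dom (\<tau> \<rightarrow>\<^sub>T \<sigma> \<rightarrow>\<^sub>T \<tau>)" for a f \<sigma> \<tau>
    using that by (auto elim!: domE simp: cnst_def app_cls_typed trm_def cls_axms)
  show "app (app (app (cnst (Lc \<sigma> \<tau>)) (app (app (cnst (Consc \<sigma>)) b) v)) a) f =
      app (app f (app (app (app (cnst (Lc \<sigma> \<tau>)) v) a) f)) b"
    if "b \<in> dom \<sigma>" "v \<in> dom (TSeq \<sigma>)" "a \<in> dom \<tau>" "f \<in> dom (\<tau> \<rightarrow>\<^sub>T \<sigma> \<rightarrow>\<^sub>T \<tau>)"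
    for b v a f \<sigma> \<tau>
    using that by (auto elim!: domE simp: cnst_def app_cls_typed trm_def cls_axms)
qed (rule term_induct)

end

text \<open>The element type is fixed to \<open>tm set\<close>, where the quotient of the terms
  lives; truth in the models over this one type suffices for derivability.\<close>

theorem completeness:
  assumes valid: "\<And>(D :: ty \<Rightarrow> tm set set) ap cn \<rho>.
      model D ap cn \<Longrightarrow> interp.env D \<rho> \<Longrightarrow> interp.sat D ap cn \<rho> \<phi>"
    and \<phi>: "wff \<phi>" "fvs \<phi> = {}" "bvs \<phi> \<inter> W = {}"
  shows "{} \<turnstile> \<phi>"
proof (rule ccontr)
  assume not: "\<not> ({} \<turnstile> \<phi>)"
  have "\<not> ({Neg \<phi>} \<turnstile> Fls)"
  proof
    assume "{Neg \<phi>} \<turnstile> Fls"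
    then have "{} \<turnstile> \<phi>" using \<phi>(1) by (rule classical)
    with not show False ..
  qed
  then obtain H where H: "henkin H" "Neg \<phi> \<in> H" using \<phi>(1) by (rule ex_henkin)
  interpret henkin_set H by unfold_locales fact
  \<comment> \<open>Some assignment is needed to evaluate \<open>\<phi>\<close>, and each variable
    is sent to a witness variable of its type. As \<open>\<phi>\<close> is closed, the substitution
    leaves it unchanged.\<close>
  define \<theta> :: "var \<Rightarrow> tm" where "\<theta> z = Var (SOME w. w \<in> W \<and> w \<notin> {} \<and> snd w = snd z)" for z
  have "\<theta> z \<in> trm (snd z)" for z
    using someI_ex[OF ex_fresh[of "{}" "snd z"]] unfolding \<theta>_def by (simp add: trm_def)
  then have \<theta>: "wenv \<theta>" by (simp add: wenv_def)
  then have "tm.env (cls \<circ> \<theta>)" by (auto simp: wenv_def tm.env_def)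
  then have "tm.sat (cls \<circ> \<theta>) \<phi>" using valid tm.model_axioms by blast
  then have "ssub \<theta> \<phi> \<in> H" using truth[OF \<theta> \<phi>(1,3)] by simp
  moreover have "ssub \<theta> \<phi> = \<phi>" using \<phi>(2) by (intro ssub_id) auto
  ultimately show False using H(2) \<phi>(1) by simp
qed


section \<open>Abstraction\<close>

declare lam.simps [simp del]

lemma vars_lam [simp]: "vars (lam x t) = vars t - {x}"
  by (induction t) (auto simp: lam.simps I_tm_def)

lemma tyof_lam [simp]: "tyof (lam x t) = map_option (TFun (snd x)) (tyof t)"
proof (induction t)
  case (App t u)
  show ?case
  proof (cases "x \<in> vars (t \<cdot> u)")
    case True
    then show ?thesis
      using App by (auto simp: lam.simps ty_the_def split: option.splits ty.splits if_splits)
  next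
    case False
    then show ?thesis
      by (auto simp: lam.simps ty_the_def split: option.splits)
  qed
qed (auto simp: lam.simps I_tm_def)

section \<open>Evaluation in a model\<close>

context model
begin

lemma env_upd [simp]: "env \<rho> \<Longrightarrow> a \<in> D (snd x) \<Longrightarrow> env (\<rho>(x := a))"
  by (simp add: env_def)

lemma ev_in [simp]: "env \<rho> \<Longrightarrow> tyof t = Some \<tau> \<Longrightarrow> ev \<rho> t \<in> D \<tau>"
proof (induction t arbitrary: \<tau>)
  case (App t u)
  obtain \<sigma> where "tyof t = Some (\<sigma> \<rightarrow>\<^sub>T \<tau>)" "tyof u = Some \<sigma>"
    using App.prems(2) by (rule tyof_AppE)
  with App show ?case by (simp add: ap_in)
qed (auto simp: env_def)

lemma ev_cong: "(\<And>x. x \<in> vars t \<Longrightarrow> \<rho> x = \<rho>' x) \<Longrightarrow> ev \<rho> t = ev \<rho>' t"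
  by (induction t) auto

text \<open>Beta conversion for bracket abstraction: the identity is S K K, S distributes the
  argument over an application containing \<open>x\<close>, and K discards it elsewhere.\<close>

lemma ev_lam:
  assumes "env \<rho>" "a \<in> D (snd x)" "tyof t \<noteq> None"
  shows "ap (ev \<rho> (lam x t)) a = ev (\<rho>(x := a)) t"
  using assms(3)
proof (induction t)
  case (Var y)
  have "ap (ap (ap (cn (Sc (snd x) (snd x \<rightarrow>\<^sub>T snd x) (snd x))) (cn (Kc (snd x) (snd x \<rightarrow>\<^sub>T snd x))))
      (cn (Kc (snd x) (snd x)))) a = a"
    using assms ap_in[of "cn (Kc (snd x) (snd x))" "snd x" "snd x \<rightarrow>\<^sub>T snd x" a]
      cn_in[of "Kc (snd x) (snd x)"] cn_in[of "Kc (snd x) (snd x \<rightarrow>\<^sub>T snd x)"]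
    by (subst S) (auto intro: K)
  moreover have "\<rho> y \<in> D (snd y)" using assms by (simp add: env_def)
  ultimately show ?case using assms by (auto simp: lam.simps I_tm_def K)
next
  case (Con c)
  then show ?case using assms by (simp add: lam.simps K)
next
  case (App t u)
  then obtain \<tau> where "tyof (t \<cdot> u) = Some \<tau>" by auto
  then obtain \<sigma> where \<sigma>: "tyof t = Some (\<sigma> \<rightarrow>\<^sub>T \<tau>)" "tyof u = Some \<sigma>" by (rule tyof_AppE)
  show ?case
  proof (cases "x \<in> vars (t \<cdot> u)")
    case True
    have "ev \<rho> (lam x t) \<in> D (snd x \<rightarrow>\<^sub>T \<sigma> \<rightarrow>\<^sub>T \<tau>)" "ev \<rho> (lam x u) \<in> D (snd x \<rightarrow>\<^sub>T \<sigma>)"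
      using \<sigma> assms by (intro ev_in; simp)+
    with True App.IH \<sigma> assms show ?thesis by (simp add: lam.simps ty_the_def S)
  next
    case False
    have "ev \<rho> (t \<cdot> u) \<in> D \<tau>" using \<sigma> assms by (intro ev_in) simp_all
    moreover have "ev (\<rho>(x := a)) (t \<cdot> u) = ev \<rho> (t \<cdot> u)"
      using False by (intro ev_cong) auto
    moreover have "lam x (t \<cdot> u) = Con (Kc \<tau> (snd x)) \<cdot> (t \<cdot> u)"
      using False \<sigma> by (simp add: lam.simps ty_the_def)
    ultimately show ?thesis using assms(2) K by (simp only: ev.simps(2,3))
  qed
qed

end

lemma tyof_zero_tm [simp]: "tyof (zero_tm \<sigma>) = Some \<sigma>"
  by (induction \<sigma>) auto

lemma vars_zero_tm [simp]: "vars (zero_tm \<sigma>) = {}"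
  by (induction \<sigma>) auto

lemma pred_tm_simps [simp]: "tyof pred_tm = Some (TNat \<rightarrow>\<^sub>T TNat)" "vars pred_tm = {}"
  by (simp_all add: pred_tm_def Let_def)

lemma plus_tm_simps [simp]:
  "tyof plus_tm = Some (TNat \<rightarrow>\<^sub>T TNat \<rightarrow>\<^sub>T TNat)" "vars plus_tm = {}"
  by (auto simp: plus_tm_def Let_def)

lemma monus_tm_simps [simp]:
  "tyof monus_tm = Some (TNat \<rightarrow>\<^sub>T TNat \<rightarrow>\<^sub>T TNat)" "vars monus_tm = {}"
  by (auto simp: monus_tm_def Let_def)

lemma len_tm_simps [simp]:
  "tyof (len_tm \<sigma>) = Some (TSeq \<sigma> \<rightarrow>\<^sub>T TNat)" "vars (len_tm \<sigma>) = {}"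
  by (auto simp: len_tm_def Let_def)

lemma append_tm_simps [simp]:
  "tyof (append_tm \<sigma>) = Some (TSeq \<sigma> \<rightarrow>\<^sub>T TSeq \<sigma> \<rightarrow>\<^sub>T TSeq \<sigma>)" "vars (append_tm \<sigma>) = {}"
  by (auto simp: append_tm_def Let_def)

lemma entry_tm_simps [simp]:
  "tyof (entry_tm \<sigma>) = Some (TSeq \<sigma> \<rightarrow>\<^sub>T TNat \<rightarrow>\<^sub>T \<sigma>)" "vars (entry_tm \<sigma>) = {}"
  by (auto simp: entry_tm_def Let_def)

lemma initseg_tm_simps [simp]:
  "tyof initseg_tm = Some (ty1 \<rightarrow>\<^sub>T TNat \<rightarrow>\<^sub>T TSeq TNat)" "vars initseg_tm = {}"
  by (auto simp: initseg_tm_def Let_def)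

lemma code_tm_simps [simp]: "tyof code_tm = Some (TSeq TNat \<rightarrow>\<^sub>T TNat)" "vars code_tm = {}"
  by (auto simp: code_tm_def Let_def)

section \<open>The witnessing terms\<close>

definition shift_tm :: tm where
  "shift_tm = (let f = (''f'', ty1); n = (''n'', TNat) in
    lam f (lam n (Var f \<cdot> (Con Succ \<cdot> Var n))))"

text \<open>The pointwise minimum with 1, obtained by a recursion on the value whose step is
  constantly one.\<close>

definition clip_tm :: tm where
  "clip_tm = (let f = (''f'', ty1); n = (''n'', TNat); p = (''p'', TNat); m = (''m'', TNat) in
    lam f (lam n (Con (Rc TNat) \<cdot> (Var f \<cdot> Var n) \<cdot> Con Zero \<cdot> lam p (lam m one))))"

definition sum_tm :: tm where
  "sum_tm = (let F = (''F'', ty2); w = (''w'', TSeq ty1); p = (''p'', TNat); a = (''a'', ty1) in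
    lam F (lam w (Con (Lc ty1 TNat) \<cdot> Var w \<cdot> Con Zero \<cdot>
      lam p (lam a (plus_tm \<cdot> Var p \<cdot> (Var F \<cdot> Var a))))))"

definition prep_tm :: tm where
  "prep_tm = (let a = (''a'', TNat); f = (''f'', ty1); n = (''n'', TNat);
      p = (''p'', TNat); m = (''m'', TNat) in
    lam a (lam f (lam n (Con (Rc TNat) \<cdot> Var n \<cdot> Var a \<cdot> lam p (lam m (Var f \<cdot> Var m))))))"

definition branch_tm :: tm where
  "branch_tm = (let w = (''w'', TSeq ty1); p = (''p'', TSeq ty1); f = (''f'', ty1) in
    lam w (Con (Lc ty1 (TSeq ty1)) \<cdot> Var w \<cdot> Con (Nilc ty1) \<cdot>
      lam p (lam f (Con (Consc ty1) \<cdot> (prep_tm \<cdot> Con Zero \<cdot> Var f) \<cdot>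
        (Con (Consc ty1) \<cdot> (prep_tm \<cdot> one \<cdot> Var f) \<cdot> Var p)))))"

text \<open>After N rounds these are 2^N functions that vanish from N on, each round prepending a
  zero and a one to every function. Prepending fits an induction that passes from a function to its
  shift. The entries are functions because the sequence has to serve as a value of the special fan
  functional.\<close>

definition binseqs_tm :: tm where
  "binseqs_tm = (let N = (''N'', TNat); p = (''p'', TSeq ty1); n = (''n'', TNat) in
    lam N (Con (Rc (TSeq ty1)) \<cdot> Var N \<cdot> (Con (Consc ty1) \<cdot> zero_tm ty1 \<cdot> Con (Nilc ty1)) \<cdot>
      lam p (lam n (branch_tm \<cdot> Var p))))"

lemma shift_tm_simps [simp]: "tyof shift_tm = Some (ty1 \<rightarrow>\<^sub>T ty1)" "vars shift_tm = {}"
  by (auto simp: shift_tm_def Let_def)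

lemma clip_tm_simps [simp]: "tyof clip_tm = Some (ty1 \<rightarrow>\<^sub>T ty1)" "vars clip_tm = {}"
  by (auto simp: clip_tm_def Let_def)

lemma sum_tm_simps [simp]: "tyof sum_tm = Some (ty2 \<rightarrow>\<^sub>T TSeq ty1 \<rightarrow>\<^sub>T TNat)" "vars sum_tm = {}"
  by (auto simp: sum_tm_def Let_def)

lemma prep_tm_simps [simp]: "tyof prep_tm = Some (TNat \<rightarrow>\<^sub>T ty1 \<rightarrow>\<^sub>T ty1)" "vars prep_tm = {}"
  by (auto simp: prep_tm_def Let_def)

lemma branch_tm_simps [simp]:
  "tyof branch_tm = Some (TSeq ty1 \<rightarrow>\<^sub>T TSeq ty1)" "vars branch_tm = {}"
  by (auto simp: branch_tm_def Let_def)

lemma binseqs_tm_simps [simp]: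
  "tyof binseqs_tm = Some (TNat \<rightarrow>\<^sub>T TSeq ty1)" "vars binseqs_tm = {}"
  by (auto simp: binseqs_tm_def Let_def)

section \<open>Values of closed terms in a model\<close>

context model
begin

text \<open>A well-typed assignment to evaluate closed terms in. The ill-typed inner assignment is
  never consulted, since \<open>zero_tm\<close> has no variables.\<close>

definition \<rho>0 :: "var \<Rightarrow> 'e" where
  "\<rho>0 z = ev (\<lambda>_. cn Zero) (zero_tm (snd z))"

lemma env_\<rho>0 [simp]: "env \<rho>0"
proof -
  have "ev \<rho> (zero_tm \<sigma>) \<in> D \<sigma>" for \<rho> \<sigma>
  proof (induction \<sigma>)
    case TNat
    then show ?case using cn_in[of Zero] by simp
  next
    case (TFun \<sigma> \<tau>)
    then show ?case using ap_in cn_in[of "Kc \<tau> \<sigma>"] by simp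
  next
    case (TProd \<sigma> \<tau>)
    then show ?case using ap_in[OF ap_in] cn_in[of "Pairc \<sigma> \<tau>"] by simp
  next
    case (TSeq \<sigma>)
    then show ?case using cn_in[of "Nilc \<sigma>"] by simp
  qed
  then show ?thesis by (simp add: env_def \<rho>0_def)
qed

definition val :: "tm \<Rightarrow> 'e" where "val t = ev \<rho>0 t"

lemma ev_val: "vars t = {} \<Longrightarrow> ev \<rho> t = val t"
  unfolding val_def by (rule ev_cong) simp

text \<open>A recursion equation compares the step function under two assignments that differ in the
  recursion argument. Dropping irrelevant updates makes both occurrences syntactically
  equal.\<close>

lemma ev_lam_fresh [simp]:
  "x \<notin> vars (lam y t) \<Longrightarrow> ev (\<rho>(x := a)) (lam y t) = ev \<rho> (lam y t)"
  by (rule ev_cong) auto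

lemmas ev_vals [simp] =
  ev_val[OF pred_tm_simps(2)] ev_val[OF plus_tm_simps(2)] ev_val[OF monus_tm_simps(2)]
  ev_val[OF len_tm_simps(2)] ev_val[OF append_tm_simps(2)] ev_val[OF entry_tm_simps(2)]
  ev_val[OF initseg_tm_simps(2)] ev_val[OF code_tm_simps(2)] ev_val[OF shift_tm_simps(2)]
  ev_val[OF clip_tm_simps(2)] ev_val[OF sum_tm_simps(2)] ev_val[OF prep_tm_simps(2)]
  ev_val[OF branch_tm_simps(2)] ev_val[OF binseqs_tm_simps(2)] ev_val[OF vars_zero_tm]

abbreviation "\<N> \<equiv> D TNat"
abbreviation "Z \<equiv> cn Zero"
abbreviation "Su \<equiv> ap (cn Succ)"
abbreviation "Nl \<sigma> \<equiv> cn (Nilc \<sigma>)"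
abbreviation "Cs \<sigma> a w \<equiv> ap (ap (cn (Consc \<sigma>)) a) w"

abbreviation "pre \<equiv> ap (val pred_tm)"
abbreviation "pls a b \<equiv> ap (ap (val plus_tm) a) b"
abbreviation "mon a b \<equiv> ap (ap (val monus_tm) a) b"
abbreviation "ln \<sigma> \<equiv> ap (val (len_tm \<sigma>))"
abbreviation "app \<sigma> w v \<equiv> ap (ap (val (append_tm \<sigma>)) w) v"
abbreviation "ent \<sigma> w i \<equiv> ap (ap (val (entry_tm \<sigma>)) w) i"
abbreviation "ini f n \<equiv> ap (ap (val initseg_tm) f) n"
abbreviation "code \<equiv> ap (val code_tm)"
abbreviation "shift \<equiv> ap (val shift_tm)"
abbreviation "clip \<equiv> ap (val clip_tm)"
abbreviation "sm F w \<equiv> ap (ap (val sum_tm) F) w"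
abbreviation "prep a f \<equiv> ap (ap (val prep_tm) a) f"
abbreviation "branch \<equiv> ap (val branch_tm)"
abbreviation "binseqs \<equiv> ap (val binseqs_tm)"

lemma val_in: "vars t = {} \<Longrightarrow> tyof t = Some \<tau> \<Longrightarrow> val t \<in> D \<tau>"
  by (simp add: val_def)

lemma val_zero_in [simp]: "val (zero_tm \<sigma>) \<in> D \<sigma>"
  by (simp add: val_in)

lemma typing [simp]:
  "Z \<in> \<N>"
  "a \<in> \<N> \<Longrightarrow> Su a \<in> \<N>"
  "Nl \<sigma> \<in> D (TSeq \<sigma>)"
  "b \<in> D \<sigma> \<Longrightarrow> w \<in> D (TSeq \<sigma>) \<Longrightarrow> Cs \<sigma> b w \<in> D (TSeq \<sigma>)"
  "a \<in> \<N> \<Longrightarrow> c \<in> D \<tau> \<Longrightarrow> f \<in> D (\<tau> \<rightarrow>\<^sub>T TNat \<rightarrow>\<^sub>T \<tau>) \<Longrightarrow> ap (ap (ap (cn (Rc \<tau>)) a) c) f \<in> D \<tau>"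
  "w \<in> D (TSeq \<sigma>) \<Longrightarrow> c \<in> D \<tau> \<Longrightarrow> g \<in> D (\<tau> \<rightarrow>\<^sub>T \<sigma> \<rightarrow>\<^sub>T \<tau>) \<Longrightarrow>
    ap (ap (ap (cn (Lc \<sigma> \<tau>)) w) c) g \<in> D \<tau>"
  "b \<in> D \<sigma> \<Longrightarrow> ap (cn (Kc \<sigma> \<tau>)) b \<in> D (\<tau> \<rightarrow>\<^sub>T \<sigma>)"
  using cn_in[of Zero] cn_in[of Succ] cn_in[of "Nilc \<sigma>"] cn_in[of "Consc \<sigma>"] cn_in[of "Rc \<tau>"]
    cn_in[of "Lc \<sigma> \<tau>"] cn_in[of "Kc \<sigma> \<tau>"]
  by (auto intro: ap_in)

lemma ap_in1 [simp]: "h \<in> D (TNat \<rightarrow>\<^sub>T \<tau>) \<Longrightarrow> a \<in> \<N> \<Longrightarrow> ap h a \<in> D \<tau>"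
  by (rule ap_in)

lemma ap_in2 [simp]: "h \<in> D (ty1 \<rightarrow>\<^sub>T \<tau>) \<Longrightarrow> f \<in> D ty1 \<Longrightarrow> ap h f \<in> D \<tau>"
  by (rule ap_in)

lemma typing_val [simp]:
  "a \<in> \<N> \<Longrightarrow> pre a \<in> \<N>"
  "a \<in> \<N> \<Longrightarrow> b \<in> \<N> \<Longrightarrow> pls a b \<in> \<N>"
  "a \<in> \<N> \<Longrightarrow> b \<in> \<N> \<Longrightarrow> mon a b \<in> \<N>"
  "w \<in> D (TSeq \<sigma>) \<Longrightarrow> ln \<sigma> w \<in> \<N>"
  "w \<in> D (TSeq \<sigma>) \<Longrightarrow> v \<in> D (TSeq \<sigma>) \<Longrightarrow> app \<sigma> w v \<in> D (TSeq \<sigma>)"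
  "w \<in> D (TSeq \<sigma>) \<Longrightarrow> a \<in> \<N> \<Longrightarrow> ent \<sigma> w a \<in> D \<sigma>"
  "f \<in> D ty1 \<Longrightarrow> a \<in> \<N> \<Longrightarrow> ini f a \<in> D (TSeq TNat)"
  "u \<in> D (TSeq TNat) \<Longrightarrow> code u \<in> \<N>"
  "f \<in> D ty1 \<Longrightarrow> shift f \<in> D ty1"
  "f \<in> D ty1 \<Longrightarrow> clip f \<in> D ty1"
  "F \<in> D ty2 \<Longrightarrow> x \<in> D (TSeq ty1) \<Longrightarrow> sm F x \<in> \<N>"
  "a \<in> \<N> \<Longrightarrow> f \<in> D ty1 \<Longrightarrow> prep a f \<in> D ty1"
  "x \<in> D (TSeq ty1) \<Longrightarrow> branch x \<in> D (TSeq ty1)"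
  "a \<in> \<N> \<Longrightarrow> binseqs a \<in> D (TSeq ty1)"
  using val_in[OF pred_tm_simps(2,1)] val_in[OF plus_tm_simps(2,1)] val_in[OF monus_tm_simps(2,1)]
    val_in[OF len_tm_simps(2,1), of \<sigma>] val_in[OF append_tm_simps(2,1), of \<sigma>]
    val_in[OF entry_tm_simps(2,1), of \<sigma>] val_in[OF initseg_tm_simps(2,1)]
    val_in[OF code_tm_simps(2,1)] val_in[OF shift_tm_simps(2,1)] val_in[OF clip_tm_simps(2,1)]
    val_in[OF sum_tm_simps(2,1)] val_in[OF prep_tm_simps(2,1)] val_in[OF branch_tm_simps(2,1)]
    val_in[OF binseqs_tm_simps(2,1)]
  by (blast intro: ap_in)+

section \<open>Recursion equations of the closed terms\<close>

lemmas compute = Let_def ev_lam R_Zero R_Succ L_Nil L_Cons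

lemma val_pred: "pre Z = Z" "a \<in> \<N> \<Longrightarrow> pre (Su a) = a"
  unfolding val_def pred_tm_def by (simp_all add: compute)

lemma val_plus:
  "a \<in> \<N> \<Longrightarrow> pls a Z = a"
  "a \<in> \<N> \<Longrightarrow> b \<in> \<N> \<Longrightarrow> pls a (Su b) = Su (pls a b)"
  unfolding val_def plus_tm_def by (simp_all add: compute)

lemma val_monus:
  "a \<in> \<N> \<Longrightarrow> mon a Z = a"
  "a \<in> \<N> \<Longrightarrow> b \<in> \<N> \<Longrightarrow> mon a (Su b) = pre (mon a b)"
  unfolding val_def[of monus_tm] unfolding monus_tm_def by (simp_all add: compute)

lemma val_len:
  "ln \<sigma> (Nl \<sigma>) = Z"
  "a \<in> D \<sigma> \<Longrightarrow> w \<in> D (TSeq \<sigma>) \<Longrightarrow> ln \<sigma> (Cs \<sigma> a w) = Su (ln \<sigma> w)"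
  unfolding val_def len_tm_def by (simp_all add: compute)

lemma val_append:
  "v \<in> D (TSeq \<sigma>) \<Longrightarrow> app \<sigma> (Nl \<sigma>) v = v"
  "a \<in> D \<sigma> \<Longrightarrow> w \<in> D (TSeq \<sigma>) \<Longrightarrow> v \<in> D (TSeq \<sigma>) \<Longrightarrow>
    app \<sigma> (Cs \<sigma> a w) v = Cs \<sigma> a (app \<sigma> w v)"
  unfolding val_def append_tm_def by (simp_all add: compute)

lemma val_entry:
  "a \<in> D \<sigma> \<Longrightarrow> w \<in> D (TSeq \<sigma>) \<Longrightarrow> ent \<sigma> (Cs \<sigma> a w) Z = a"
  "a \<in> D \<sigma> \<Longrightarrow> w \<in> D (TSeq \<sigma>) \<Longrightarrow> i \<in> \<N> \<Longrightarrow> ent \<sigma> (Cs \<sigma> a w) (Su i) = ent \<sigma> w i"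
  unfolding val_def entry_tm_def by (simp_all add: compute)

lemma val_initseg:
  "f \<in> D ty1 \<Longrightarrow> ini f Z = Nl TNat"
  "f \<in> D ty1 \<Longrightarrow> n \<in> \<N> \<Longrightarrow> ini f (Su n) = app TNat (ini f n) (Cs TNat (ap f n) (Nl TNat))"
  unfolding val_def[of initseg_tm] unfolding initseg_tm_def by (simp_all add: compute)

lemma val_shift: "f \<in> D ty1 \<Longrightarrow> n \<in> \<N> \<Longrightarrow> ap (shift f) n = ap f (Su n)"
  unfolding val_def shift_tm_def by (simp add: compute)

lemma val_clip:
  "f \<in> D ty1 \<Longrightarrow> n \<in> \<N> \<Longrightarrow> ap f n = Z \<Longrightarrow> ap (clip f) n = Z"
  "f \<in> D ty1 \<Longrightarrow> n \<in> \<N> \<Longrightarrow> a \<in> \<N> \<Longrightarrow> ap f n = Su a \<Longrightarrow> ap (clip f) n = Su Z"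
  unfolding val_def clip_tm_def by (simp_all add: compute)

lemma val_sum:
  "F \<in> D ty2 \<Longrightarrow> sm F (Nl ty1) = Z"
  "F \<in> D ty2 \<Longrightarrow> a \<in> D ty1 \<Longrightarrow> w \<in> D (TSeq ty1) \<Longrightarrow>
    sm F (Cs ty1 a w) = pls (sm F w) (ap F a)"
  unfolding val_def[of sum_tm] unfolding sum_tm_def by (simp_all add: compute)

lemma val_prep:
  "a \<in> \<N> \<Longrightarrow> f \<in> D ty1 \<Longrightarrow> ap (prep a f) Z = a"
  "a \<in> \<N> \<Longrightarrow> f \<in> D ty1 \<Longrightarrow> n \<in> \<N> \<Longrightarrow> ap (prep a f) (Su n) = ap f n"
  unfolding val_def prep_tm_def by (simp_all add: compute)

lemma val_branch:
  "branch (Nl ty1) = Nl ty1"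
  "f \<in> D ty1 \<Longrightarrow> w \<in> D (TSeq ty1) \<Longrightarrow>
    branch (Cs ty1 f w) = Cs ty1 (prep Z f) (Cs ty1 (prep (Su Z) f) (branch w))"
  unfolding val_def[of branch_tm] unfolding branch_tm_def by (simp_all add: compute)

lemma val_binseqs:
  "binseqs Z = Cs ty1 (ap (cn (Kc TNat TNat)) Z) (Nl ty1)"
  "n \<in> \<N> \<Longrightarrow> binseqs (Su n) = branch (binseqs n)"
  unfolding val_def[of binseqs_tm] unfolding binseqs_tm_def by (simp_all add: compute)

text \<open>The successor equation of \<open>initseg_tm\<close> stays out: it appends at the end,
  while length and entries are computed from the front, where \<open>ini_Su\<close> is the suitable
  form.\<close>

lemmas vals [simp] = val_pred val_plus val_monus val_len val_append val_entry val_initseg(1)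
  val_shift val_sum val_prep val_branch val_binseqs

end


section \<open>Arithmetic and sequences in a model\<close>

abbreviation (input) "vn \<equiv> (''n'', TNat)"
abbreviation (input) "vm \<equiv> (''m'', TNat)"
abbreviation (input) "vk \<equiv> (''k'', TNat)"
abbreviation (input) "vf \<equiv> (''f'', ty1)"
abbreviation (input) "vg \<equiv> (''g'', ty1)"
abbreviation (input) "vF \<equiv> (''F'', ty2)"
abbreviation (input) "vx \<equiv> (''x'', TSeq ty1)"

lemma Binary_simps [simp]:
  "tyof t = Some ty1 \<Longrightarrow> wff (Binary t)"
  "bvs (Binary t) = {vn}"
  "fvs (Binary t) = vars t - {vn}"
  by (auto simp: Binary_def Let_def)

lemma InSeq_simps [simp]:
  "tyof t = Some \<sigma> \<Longrightarrow> tyof w = Some (TSeq \<sigma>) \<Longrightarrow> wff (InSeq \<sigma> t w)"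
  "bvs (InSeq \<sigma> t w) = {(''i'', TNat)}"
  "fvs (InSeq \<sigma> t w) = vars t \<union> vars w - {(''i'', TNat)}"
  by (auto simp: InSeq_def Let_def)

lemma Extends_simps [simp]:
  "tyof t = Some ty1 \<Longrightarrow> tyof w = Some (TSeq TNat) \<Longrightarrow> wff (Extends t w)"
  "bvs (Extends t w) = {(''i'', TNat)}"
  "fvs (Extends t w) = vars t \<union> vars w - {(''i'', TNat)}"
  by (auto simp: Extends_def Let_def)

lemma BinarySeq_simps [simp]:
  "tyof w = Some (TSeq TNat) \<Longrightarrow> wff (BinarySeq w)"
  "bvs (BinarySeq w) = {(''i'', TNat)}"
  "fvs (BinarySeq w) = vars w - {(''i'', TNat)}"
  by (auto simp: BinarySeq_def Let_def)

lemma short_notin_W [simp]: "length s \<le> 5 \<Longrightarrow> (s, \<tau>) \<notin> W"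
  by (simp add: W_def)

section \<open>Induction for definable properties, order of numbers, initial segments\<close>

context model
begin

text \<open>Induction in a model reaches only definable properties. Each use therefore pairs the
  predicate \<open>P\<close> with a formula defining it in the variable \<open>vn\<close>; further
  parameters are quantified inside the formula or stored in \<open>\<rho>\<close>.\<close>

lemma formula_induct:
  assumes "b \<in> \<N>" "env \<rho>" "wff \<phi>" "bvs \<phi> \<inter> W = {}"
    and sat: "\<And>a. a \<in> \<N> \<Longrightarrow> sat (\<rho>(vn := a)) \<phi> \<longleftrightarrow> P a"
    and "P Z" "\<And>a. a \<in> \<N> \<Longrightarrow> P a \<Longrightarrow> P (Su a)"
  shows "P b"
proof -
  have "sat (\<rho>(vn := b)) \<phi>"
  proof (rule induct)
    show "sat (\<rho>(vn := Z)) \<phi>" using assms(6) sat by simp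
    show "sat (\<rho>(vn := Su a)) \<phi>" if "a \<in> \<N>" "sat (\<rho>(vn := a)) \<phi>" for a
      using assms(7) sat that by simp
  qed (use assms in auto)
  with sat assms(1) show ?thesis by simp
qed

lemma Su_neq [simp]: "a \<in> \<N> \<Longrightarrow> Su a \<noteq> Z" "a \<in> \<N> \<Longrightarrow> Z \<noteq> Su a"
  using Succ_not_Zero by metis+

text \<open>A nonstandard number has no numeral to inspect, so the existence of a predecessor is
  itself proved by induction.\<close>

lemma nat_cases:
  assumes "n \<in> \<N>"
  obtains "n = Z" | m where "m \<in> \<N>" "n = Su m"
proof -
  have "n = Z \<or> (\<exists>m\<in>\<N>. n = Su m)"
    by (rule formula_induct[OF assms, where \<rho> = \<rho>0
        and \<phi> = "Var vn \<^bold>= Con Zero \<^bold>\<or> Exists vm (Var vn \<^bold>= Con Succ \<cdot> Var vm)"])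
      auto
  with that show thesis by blast
qed

abbreviation "le a b \<equiv> mon a b = Z"

text \<open>Cut-off subtraction recurses on its second argument through the predecessor, and the
  predecessor of \<open>Su a\<close> absorbs the extra successor. This rule takes over from the
  defining successor equation, which leaves the simplifier after \<open>le_Su\<close>.\<close>

lemma mon_Su_Su [simp]: "a \<in> \<N> \<Longrightarrow> b \<in> \<N> \<Longrightarrow> mon (Su a) (Su b) = mon a b"
  by (rule bspec[of \<N>], rule formula_induct[of b, where \<rho> = \<rho>0
      and P = "\<lambda>b. \<forall>a\<in>\<N>. mon (Su a) (Su b) = mon a b"
      and \<phi> = "Forall vm (monus_tm \<cdot> (Con Succ \<cdot> Var vm) \<cdot> (Con Succ \<cdot> Var vn) \<^bold>= monus_tm \<cdot> Var vm \<cdot> Var vn)"])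
    simp_all

lemma le_Su: "a \<in> \<N> \<Longrightarrow> b \<in> \<N> \<Longrightarrow> le a b \<Longrightarrow> le a (Su b)"
  by simp

declare val_monus(2) [simp del]

lemma le_Z [simp]: "b \<in> \<N> \<Longrightarrow> le Z b"
  by (rule formula_induct[of b, where \<rho> = \<rho>0 and P = "\<lambda>b. le Z b"
      and \<phi> = "Le (Con Zero) (Var vn)"])
    (simp_all add: le_Su)

lemma le_refl [simp]: "b \<in> \<N> \<Longrightarrow> le b b"
  by (rule formula_induct[of b, where \<rho> = \<rho>0 and P = "\<lambda>b. le b b"
      and \<phi> = "Le (Var vn) (Var vn)"])
    simp_all

text \<open>Induction on \<open>b\<close> for all \<open>a\<close> at once: if \<open>a\<close> is a
  successor, both sides of the comparison lose one and the hypothesis applies.\<close>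

lemma le_SuE:
  assumes "b \<in> \<N>" "a \<in> \<N>" "le a (Su b)"
  shows "a = Su b \<or> le a b"
proof -
  have "\<forall>a\<in>\<N>. le a (Su b) \<longrightarrow> a = Su b \<or> le a b"
  proof (rule formula_induct[OF assms(1), where \<rho> = \<rho>0
        and P = "\<lambda>b. \<forall>a\<in>\<N>. le a (Su b) \<longrightarrow> a = Su b \<or> le a b"
        and \<phi> = "Forall vm (Le (Var vm) (Con Succ \<cdot> Var vn) \<^bold>\<longrightarrow>
          Var vm \<^bold>= Con Succ \<cdot> Var vn \<^bold>\<or> Le (Var vm) (Var vn))"])
    show "\<forall>a\<in>\<N>. le a (Su Z) \<longrightarrow> a = Su Z \<or> le a Z"
    proof (intro ballI HOL.impI)
      fix a assume a: "a \<in> \<N>" "le a (Su Z)"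
      from a(1) show "a = Su Z \<or> le a Z"
        by (rule nat_cases) (use a in auto)
    qed
    fix b assume b: "b \<in> \<N>" and IH: "\<forall>a\<in>\<N>. le a (Su b) \<longrightarrow> a = Su b \<or> le a b"
    show "\<forall>a\<in>\<N>. le a (Su (Su b)) \<longrightarrow> a = Su (Su b) \<or> le a (Su b)"
    proof (intro ballI HOL.impI)
      fix a assume a: "a \<in> \<N>" "le a (Su (Su b))"
      from a(1) show "a = Su (Su b) \<or> le a (Su b)"
      proof (rule nat_cases)
        fix c assume "c \<in> \<N>" "a = Su c"
        with a b IH show ?thesis by auto
      qed (use b in simp)
    qed
  qed simp_all
  with assms show ?thesis by blast
qed

lemma le_trans:
  assumes "a \<in> \<N>" "b \<in> \<N>" "c \<in> \<N>" "le a b" "le b c"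
  shows "le a c"
proof -
  have "\<forall>a\<in>\<N>. \<forall>b\<in>\<N>. le a b \<longrightarrow> le b c \<longrightarrow> le a c"
  proof (rule formula_induct[OF assms(3), where \<rho> = \<rho>0
        and P = "\<lambda>c. \<forall>a\<in>\<N>. \<forall>b\<in>\<N>. le a b \<longrightarrow> le b c \<longrightarrow> le a c"
        and \<phi> = "Forall vm (Forall vk (Le (Var vm) (Var vk) \<^bold>\<longrightarrow> Le (Var vk) (Var vn) \<^bold>\<longrightarrow>
          Le (Var vm) (Var vn)))"])
    fix c assume c: "c \<in> \<N>" and IH: "\<forall>a\<in>\<N>. \<forall>b\<in>\<N>. le a b \<longrightarrow> le b c \<longrightarrow> le a c"
    show "\<forall>a\<in>\<N>. \<forall>b\<in>\<N>. le a b \<longrightarrow> le b (Su c) \<longrightarrow> le a (Su c)"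
      using le_SuE le_Su IH c by metis
  qed simp_all
  with assms show ?thesis by blast
qed

lemma le_plus1: "a \<in> \<N> \<Longrightarrow> b \<in> \<N> \<Longrightarrow> le a (pls a b)"
  by (rule bspec[of \<N>], rule formula_induct[of b, where \<rho> = \<rho>0
      and P = "\<lambda>b. \<forall>a\<in>\<N>. le a (pls a b)"
      and \<phi> = "Forall vm (Le (Var vm) (plus_tm \<cdot> Var vm \<cdot> Var vn))"])
    (simp_all add: le_Su)

lemma le_plus2: "a \<in> \<N> \<Longrightarrow> b \<in> \<N> \<Longrightarrow> le b (pls a b)"
  by (rule bspec[of \<N>], rule formula_induct[of b, where \<rho> = \<rho>0
      and P = "\<lambda>b. \<forall>a\<in>\<N>. le b (pls a b)"
      and \<phi> = "Forall vm (Le (Var vn) (plus_tm \<cdot> Var vm \<cdot> Var vn))"])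
    simp_all

text \<open>Appending a last value commutes with putting the value at zero in front, and the last
  value is a value of \<open>shift f\<close>. This turns the recursion at the end into one from the
  front.\<close>

lemma ini_Su:
  assumes "n \<in> \<N>" "f \<in> D ty1"
  shows "ini f (Su n) = Cs TNat (ap f Z) (ini (shift f) n)"
proof -
  have "\<forall>f\<in>D ty1. ini f (Su n) = Cs TNat (ap f Z) (ini (shift f) n)"
    by (rule formula_induct[OF assms(1), where \<rho> = \<rho>0
        and P = "\<lambda>n. \<forall>f\<in>D ty1. ini f (Su n) = Cs TNat (ap f Z) (ini (shift f) n)"
        and \<phi> = "Forall vf (initseg (Var vf) (Con Succ \<cdot> Var vn) \<^bold>=
          Con (Consc TNat) \<cdot> (Var vf \<cdot> Con Zero) \<cdot> initseg (shift_tm \<cdot> Var vf) (Var vn))"])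
      (simp_all add: val_initseg(2))
  with assms show ?thesis by blast
qed

lemma len_ini [simp]:
  assumes "f \<in> D ty1" "n \<in> \<N>"
  shows "ln TNat (ini f n) = n"
proof -
  have "\<forall>f\<in>D ty1. ln TNat (ini f n) = n"
    by (rule formula_induct[OF assms(2), where \<rho> = \<rho>0
        and P = "\<lambda>n. \<forall>f\<in>D ty1. ln TNat (ini f n) = n"
        and \<phi> = "Forall vf (len TNat (initseg (Var vf) (Var vn)) \<^bold>= Var vn)"])
      (simp_all add: ini_Su)
  with assms show ?thesis by blast
qed

lemma entry_ini:
  assumes "f \<in> D ty1" "n \<in> \<N>" "i \<in> \<N>" "le (Su i) n"
  shows "ent TNat (ini f n) i = ap f i"
proof -
  have "\<forall>f\<in>D ty1. \<forall>i\<in>\<N>. le (Su i) n \<longrightarrow> ent TNat (ini f n) i = ap f i"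
  proof (rule formula_induct[OF assms(2), where \<rho> = \<rho>0
        and P = "\<lambda>n. \<forall>f\<in>D ty1. \<forall>i\<in>\<N>. le (Su i) n \<longrightarrow> ent TNat (ini f n) i = ap f i"
        and \<phi> = "Forall vf (Forall vk (Less (Var vk) (Var vn) \<^bold>\<longrightarrow>
          entry TNat (initseg (Var vf) (Var vn)) (Var vk) \<^bold>= Var vf \<cdot> Var vk))"])
    fix n assume n: "n \<in> \<N>"
      and IH: "\<forall>f\<in>D ty1. \<forall>i\<in>\<N>. le (Su i) n \<longrightarrow> ent TNat (ini f n) i = ap f i"
    show "\<forall>f\<in>D ty1. \<forall>i\<in>\<N>. le (Su i) (Su n) \<longrightarrow> ent TNat (ini f (Su n)) i = ap f i"
    proof (intro ballI HOL.impI)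
      fix f i assume f: "f \<in> D ty1" and i: "i \<in> \<N>" "le (Su i) (Su n)"
      from i(1) show "ent TNat (ini f (Su n)) i = ap f i"
        by (rule nat_cases) (use f i n IH in \<open>auto simp: ini_Su\<close>)
    qed
  qed simp_all
  with assms show ?thesis by blast
qed

lemma ini_eqI:
  assumes "f \<in> D ty1" "g \<in> D ty1" "n \<in> \<N>" "\<And>i. i \<in> \<N> \<Longrightarrow> le (Su i) n \<Longrightarrow> ap f i = ap g i"
  shows "ini f n = ini g n"
proof -
  have "\<forall>f\<in>D ty1. \<forall>g\<in>D ty1. (\<forall>i\<in>\<N>. le (Su i) n \<longrightarrow> ap f i = ap g i) \<longrightarrow> ini f n = ini g n"
  proof (rule formula_induct[OF assms(3), where \<rho> = \<rho>0
        and P = "\<lambda>n. \<forall>f\<in>D ty1. \<forall>g\<in>D ty1.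
          (\<forall>i\<in>\<N>. le (Su i) n \<longrightarrow> ap f i = ap g i) \<longrightarrow> ini f n = ini g n"
        and \<phi> = "Forall vf (Forall vg (
          Forall vk (Less (Var vk) (Var vn) \<^bold>\<longrightarrow> Var vf \<cdot> Var vk \<^bold>= Var vg \<cdot> Var vk) \<^bold>\<longrightarrow>
          initseg (Var vf) (Var vn) \<^bold>= initseg (Var vg) (Var vn)))"])
    fix n assume n: "n \<in> \<N>" and IH: "\<forall>f\<in>D ty1. \<forall>g\<in>D ty1.
      (\<forall>i\<in>\<N>. le (Su i) n \<longrightarrow> ap f i = ap g i) \<longrightarrow> ini f n = ini g n"
    show "\<forall>f\<in>D ty1. \<forall>g\<in>D ty1.
      (\<forall>i\<in>\<N>. le (Su i) (Su n) \<longrightarrow> ap f i = ap g i) \<longrightarrow> ini f (Su n) = ini g (Su n)"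
    proof (intro ballI HOL.impI)
      fix f g assume fg: "f \<in> D ty1" "g \<in> D ty1"
        and eq: "\<forall>i\<in>\<N>. le (Su i) (Su n) \<longrightarrow> ap f i = ap g i"
      have "le (Su i) (Su n)" if "i \<in> \<N>" "le (Su i) n" for i
        by (rule le_Su) (use that n in simp_all)
      then have "ini f n = ini g n" using IH fg eq by blast
      moreover have "ap f n = ap g n" using eq n by simp
      ultimately show "ini f (Su n) = ini g (Su n)" using fg n by (simp add: val_initseg(2))
    qed
  qed simp_all
  with assms show ?thesis by blast
qed

section \<open>The defined formulas read as properties of elements\<close>

definition mem :: "ty \<Rightarrow> 'e \<Rightarrow> 'e \<Rightarrow> bool" where
  "mem \<sigma> g w \<longleftrightarrow> (\<exists>i\<in>\<N>. le (Su i) (ln \<sigma> w) \<and> g = ent \<sigma> w i)"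

definition bin :: "'e \<Rightarrow> bool" where
  "bin f \<longleftrightarrow> (\<forall>n\<in>\<N>. le (ap f n) (Su Z))"

definition extends :: "'e \<Rightarrow> 'e \<Rightarrow> bool" where
  "extends f w \<longleftrightarrow> (\<forall>i\<in>\<N>. le (Su i) (ln TNat w) \<longrightarrow> ap f i = ent TNat w i)"

definition binseq :: "'e \<Rightarrow> bool" where
  "binseq w \<longleftrightarrow> (\<forall>i\<in>\<N>. le (Su i) (ln TNat w) \<longrightarrow> le (ent TNat w i) (Su Z))"

definition tree :: "'e \<Rightarrow> bool" where
  "tree T \<longleftrightarrow> bin T \<and> (\<forall>u\<in>D (TSeq TNat). \<forall>v\<in>D (TSeq TNat). binseq u \<longrightarrow> binseq v \<longrightarrow>
    ap T (code (app TNat u v)) = Su Z \<longrightarrow> ap T (code u) = Su Z)"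

lemma ev_upd_fresh: "x \<notin> vars t \<Longrightarrow> ev (\<rho>(x := a)) t = ev \<rho> t"
  by (rule ev_cong) auto

lemma sat_Binary [simp]: "vn \<notin> vars t \<Longrightarrow> sat \<rho> (Binary t) \<longleftrightarrow> bin (ev \<rho> t)"
  by (simp add: Binary_def Let_def bin_def ev_upd_fresh)

lemma sat_InSeq [simp]:
  "(''i'', TNat) \<notin> vars t \<union> vars w \<Longrightarrow> sat \<rho> (InSeq \<sigma> t w) \<longleftrightarrow> mem \<sigma> (ev \<rho> t) (ev \<rho> w)"
  by (simp add: InSeq_def Let_def mem_def ev_upd_fresh)

lemma sat_Extends [simp]:
  "(''i'', TNat) \<notin> vars t \<union> vars w \<Longrightarrow> sat \<rho> (Extends t w) \<longleftrightarrow> extends (ev \<rho> t) (ev \<rho> w)"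
  by (simp add: Extends_def Let_def extends_def ev_upd_fresh)

lemma sat_BinarySeq [simp]:
  "(''i'', TNat) \<notin> vars w \<Longrightarrow> sat \<rho> (BinarySeq w) \<longleftrightarrow> binseq (ev \<rho> w)"
  by (simp add: BinarySeq_def Let_def binseq_def ev_upd_fresh)

lemma sat_Tree [simp]:
  "(''u'', TSeq TNat) \<notin> vars T \<Longrightarrow> (''v'', TSeq TNat) \<notin> vars T \<Longrightarrow> vn \<notin> vars T \<Longrightarrow>
    sat \<rho> (Tree T) \<longleftrightarrow> tree (ev \<rho> T)"
  by (simp add: Tree_def InTree_def Let_def tree_def ev_upd_fresh)

lemma binE:
  assumes "bin f" "f \<in> D ty1" "n \<in> \<N>"
  obtains "ap f n = Z" | "ap f n = Su Z"
proof -
  have "ap f n \<in> \<N>" "le (ap f n) (Su Z)" using assms by (auto simp: bin_def)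
  then have "ap f n = Z \<or> ap f n = Su Z" using le_SuE[of Z "ap f n"] by auto
  with that show thesis by blast
qed

lemma bin_clip:
  assumes "f \<in> D ty1"
  shows "bin (clip f)"
  unfolding bin_def
proof
  fix n assume n: "n \<in> \<N>"
  then have "ap f n \<in> \<N>" using assms by simp
  then show "le (ap (clip f) n) (Su Z)"
    by (rule nat_cases) (use assms n val_clip in auto)
qed

lemma clip_id: "f \<in> D ty1 \<Longrightarrow> n \<in> \<N> \<Longrightarrow> le (ap f n) (Su Z) \<Longrightarrow> ap (clip f) n = ap f n"
  using le_SuE[of Z "ap f n"] val_clip(1)[of f n] val_clip(2)[of f n Z] by auto

section \<open>Finite sequences of functions: membership, sums, enumeration of binary
  functions\<close>

lemma mem_Cons:
  assumes "a \<in> D \<sigma>" "w \<in> D (TSeq \<sigma>)"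
  shows "mem \<sigma> g (Cs \<sigma> a w) \<longleftrightarrow> g = a \<or> mem \<sigma> g w"
proof
  assume "mem \<sigma> g (Cs \<sigma> a w)"
  then obtain i where i: "i \<in> \<N>" "le (Su i) (ln \<sigma> (Cs \<sigma> a w))" "g = ent \<sigma> (Cs \<sigma> a w) i"
    by (auto simp: mem_def)
  from i(1) show "g = a \<or> mem \<sigma> g w"
    by (rule nat_cases) (use i assms in \<open>auto simp: mem_def\<close>)
next
  assume "g = a \<or> mem \<sigma> g w"
  then show "mem \<sigma> g (Cs \<sigma> a w)"
  proof
    assume "mem \<sigma> g w"
    then obtain i where "i \<in> \<N>" "le (Su i) (ln \<sigma> w)" "g = ent \<sigma> w i" by (auto simp: mem_def)
    with assms show ?thesis unfolding mem_def by (intro bexI[of _ "Su i"]) auto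
  qed (use assms in \<open>auto simp: mem_def intro!: bexI[of _ Z]\<close>)
qed

text \<open>The induction is on the position of the entry, for all sequences at once, with
  \<open>seq_exhaust\<close> splitting off the head: the head is the right summand, and an entry of
  the tail is bounded by the left one.\<close>

lemma le_sum:
  assumes "F \<in> D ty2" "w \<in> D (TSeq ty1)" "mem ty1 a w"
  shows "le (ap F a) (sm F w)"
proof -
  obtain i where i: "i \<in> \<N>" "le (Su i) (ln ty1 w)" "a = ent ty1 w i"
    using assms(3) by (auto simp: mem_def)
  have "\<forall>F\<in>D ty2. \<forall>w\<in>D (TSeq ty1). le (Su i) (ln ty1 w) \<longrightarrow> le (ap F (ent ty1 w i)) (sm F w)"
  proof (rule formula_induct[OF i(1), where \<rho> = \<rho>0
        and P = "\<lambda>i. \<forall>F\<in>D ty2. \<forall>w\<in>D (TSeq ty1). le (Su i) (ln ty1 w) \<longrightarrow>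
          le (ap F (ent ty1 w i)) (sm F w)"
        and \<phi> = "Forall vF (Forall vx (Less (Var vn) (len ty1 (Var vx)) \<^bold>\<longrightarrow>
          Le (Var vF \<cdot> entry ty1 (Var vx) (Var vn)) (sum_tm \<cdot> Var vF \<cdot> Var vx)))"])
    show "\<forall>F\<in>D ty2. \<forall>w\<in>D (TSeq ty1). le (Su Z) (ln ty1 w) \<longrightarrow> le (ap F (ent ty1 w Z)) (sm F w)"
    proof (intro ballI HOL.impI)
      fix F w assume "F \<in> D ty2" "w \<in> D (TSeq ty1)" "le (Su Z) (ln ty1 w)"
      then show "le (ap F (ent ty1 w Z)) (sm F w)"
        using seq_exhaust[of w ty1] by (auto simp: le_plus2)
    qed
    fix i assume i: "i \<in> \<N>" and IH: "\<forall>F\<in>D ty2. \<forall>w\<in>D (TSeq ty1). le (Su i) (ln ty1 w) \<longrightarrow>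
      le (ap F (ent ty1 w i)) (sm F w)"
    show "\<forall>F\<in>D ty2. \<forall>w\<in>D (TSeq ty1). le (Su (Su i)) (ln ty1 w) \<longrightarrow>
      le (ap F (ent ty1 w (Su i))) (sm F w)"
    proof (intro ballI HOL.impI)
      fix F w assume F: "F \<in> D ty2" and w: "w \<in> D (TSeq ty1)" "le (Su (Su i)) (ln ty1 w)"
      then obtain a v where v: "a \<in> D ty1" "v \<in> D (TSeq ty1)" "w = Cs ty1 a v"
        using seq_exhaust[of w ty1] i by auto
      then have "le (ap F (ent ty1 v i)) (sm F v)" using IH F w i by simp
      then have "le (ap F (ent ty1 v i)) (pls (sm F v) (ap F a))"
        using F v i le_plus1[of "sm F v" "ap F a"]
          le_trans[of "ap F (ent ty1 v i)" "sm F v" "pls (sm F v) (ap F a)"] by simp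
      with F v i show "le (ap F (ent ty1 w (Su i))) (sm F w)" by simp
    qed
  qed simp_all
  with i assms show ?thesis by blast
qed

text \<open>Induction on the position of \<open>f\<close>: at position zero the two extensions head
  the branched sequence, and at a successor they lie in the branching of the tail.\<close>

lemma mem_branch:
  assumes "w \<in> D (TSeq ty1)" "mem ty1 f w" "a = Z \<or> a = Su Z"
  shows "mem ty1 (prep a f) (branch w)"
proof -
  obtain i where i: "i \<in> \<N>" "le (Su i) (ln ty1 w)" "f = ent ty1 w i"
    using assms(2) by (auto simp: mem_def)
  have "\<forall>w\<in>D (TSeq ty1). le (Su i) (ln ty1 w) \<longrightarrow>
      mem ty1 (prep Z (ent ty1 w i)) (branch w) \<and> mem ty1 (prep (Su Z) (ent ty1 w i)) (branch w)"
  proof (rule formula_induct[OF i(1), where \<rho> = \<rho>0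
        and P = "\<lambda>i. \<forall>w\<in>D (TSeq ty1). le (Su i) (ln ty1 w) \<longrightarrow>
          mem ty1 (prep Z (ent ty1 w i)) (branch w) \<and>
          mem ty1 (prep (Su Z) (ent ty1 w i)) (branch w)"
        and \<phi> = "Forall vx (Less (Var vn) (len ty1 (Var vx)) \<^bold>\<longrightarrow>
          InSeq ty1 (prep_tm \<cdot> Con Zero \<cdot> entry ty1 (Var vx) (Var vn)) (branch_tm \<cdot> Var vx) \<^bold>\<and>
          InSeq ty1 (prep_tm \<cdot> one \<cdot> entry ty1 (Var vx) (Var vn)) (branch_tm \<cdot> Var vx))"])
    show "\<forall>w\<in>D (TSeq ty1). le (Su Z) (ln ty1 w) \<longrightarrow>
      mem ty1 (prep Z (ent ty1 w Z)) (branch w) \<and> mem ty1 (prep (Su Z) (ent ty1 w Z)) (branch w)"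
    proof (intro ballI HOL.impI)
      fix w assume "w \<in> D (TSeq ty1)" "le (Su Z) (ln ty1 w)"
      then show "mem ty1 (prep Z (ent ty1 w Z)) (branch w) \<and>
          mem ty1 (prep (Su Z) (ent ty1 w Z)) (branch w)"
        using seq_exhaust[of w ty1] by (auto simp: mem_Cons)
    qed
    fix i assume i: "i \<in> \<N>" and IH: "\<forall>w\<in>D (TSeq ty1). le (Su i) (ln ty1 w) \<longrightarrow>
      mem ty1 (prep Z (ent ty1 w i)) (branch w) \<and> mem ty1 (prep (Su Z) (ent ty1 w i)) (branch w)"
    show "\<forall>w\<in>D (TSeq ty1). le (Su (Su i)) (ln ty1 w) \<longrightarrow>
      mem ty1 (prep Z (ent ty1 w (Su i))) (branch w) \<and>
      mem ty1 (prep (Su Z) (ent ty1 w (Su i))) (branch w)"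
    proof (intro ballI HOL.impI)
      fix w assume w: "w \<in> D (TSeq ty1)" "le (Su (Su i)) (ln ty1 w)"
      then obtain a v where v: "a \<in> D ty1" "v \<in> D (TSeq ty1)" "w = Cs ty1 a v"
        using seq_exhaust[of w ty1] i by auto
      with w i IH show "mem ty1 (prep Z (ent ty1 w (Su i))) (branch w) \<and>
          mem ty1 (prep (Su Z) (ent ty1 w (Su i))) (branch w)"
        by (simp add: mem_Cons)
    qed
  qed simp_all
  with i assms show ?thesis by blast
qed

text \<open>Induction on \<open>n\<close> for all binary functions at once: an approximation of
  \<open>shift f\<close> below \<open>n\<close>, with the value of \<open>f\<close> at zero put in
  front, approximates \<open>f\<close> below \<open>Su n\<close>.\<close>

lemma binseqs_complete:
  assumes "n \<in> \<N>" "f \<in> D ty1" "bin f"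
  obtains g where "g \<in> D ty1" "mem ty1 g (binseqs n)" "bin g"
    "\<And>k. k \<in> \<N> \<Longrightarrow> le (Su k) n \<Longrightarrow> ap f k = ap g k"
proof -
  have "\<forall>f\<in>D ty1. bin f \<longrightarrow> (\<exists>g\<in>D ty1. mem ty1 g (binseqs n) \<and> bin g \<and>
    (\<forall>k\<in>\<N>. le (Su k) n \<longrightarrow> ap f k = ap g k))"
  proof (rule formula_induct[OF assms(1), where \<rho> = \<rho>0
        and P = "\<lambda>n. \<forall>f\<in>D ty1. bin f \<longrightarrow> (\<exists>g\<in>D ty1. mem ty1 g (binseqs n) \<and> bin g \<and>
          (\<forall>k\<in>\<N>. le (Su k) n \<longrightarrow> ap f k = ap g k))"
        and \<phi> = "ForallBin vf (Exists vg (InSeq ty1 (Var vg) (binseqs_tm \<cdot> Var vn) \<^bold>\<and>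
          Binary (Var vg) \<^bold>\<and>
          Forall vk (Less (Var vk) (Var vn) \<^bold>\<longrightarrow> Var vf \<cdot> Var vk \<^bold>= Var vg \<cdot> Var vk)))"])
    let ?z = "ap (cn (Kc TNat TNat)) Z"
    have "bin ?z" by (simp add: bin_def K)
    then show "\<forall>f\<in>D ty1. bin f \<longrightarrow> (\<exists>g\<in>D ty1. mem ty1 g (binseqs Z) \<and> bin g \<and>
        (\<forall>k\<in>\<N>. le (Su k) Z \<longrightarrow> ap f k = ap g k))"
      by (intro ballI HOL.impI bexI[of _ ?z]) (simp_all add: mem_Cons)
    fix n assume n: "n \<in> \<N>" and IH: "\<forall>f\<in>D ty1. bin f \<longrightarrow> (\<exists>g\<in>D ty1. mem ty1 g (binseqs n) \<and>
        bin g \<and> (\<forall>k\<in>\<N>. le (Su k) n \<longrightarrow> ap f k = ap g k))"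
    show "\<forall>f\<in>D ty1. bin f \<longrightarrow> (\<exists>g\<in>D ty1. mem ty1 g (binseqs (Su n)) \<and> bin g \<and>
        (\<forall>k\<in>\<N>. le (Su k) (Su n) \<longrightarrow> ap f k = ap g k))"
    proof (intro ballI HOL.impI)
      fix f assume f: "f \<in> D ty1" "bin f"
      then have "bin (shift f)" by (simp add: bin_def)
      then obtain g where g: "g \<in> D ty1" "mem ty1 g (binseqs n)" "bin g"
        "\<forall>k\<in>\<N>. le (Su k) n \<longrightarrow> ap (shift f) k = ap g k"
        using IH f by fastforce
      \<comment> \<open>Binarity is what guarantees that the prepended value is one of the two used
        by \<open>branch_tm\<close>.\<close>
      have f0: "ap f Z = Z \<or> ap f Z = Su Z" by (rule binE[OF f(2,1), of Z]) auto
      let ?g = "prep (ap f Z) g"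
      have "mem ty1 ?g (binseqs (Su n))" using n g f0 by (simp add: mem_branch)
      moreover have "bin ?g"
        unfolding bin_def
      proof
        fix k assume "k \<in> \<N>"
        then show "le (ap ?g k) (Su Z)"
          by (rule nat_cases) (use f g in \<open>auto simp: bin_def\<close>)
      qed
      moreover have "ap f k = ap ?g k" if "k \<in> \<N>" "le (Su k) (Su n)" for k
        using that(1) by (rule nat_cases) (use that(2) f g n in auto)
      ultimately show "\<exists>g\<in>D ty1. mem ty1 g (binseqs (Su n)) \<and> bin g \<and>
          (\<forall>k\<in>\<N>. le (Su k) (Su n) \<longrightarrow> ap f k = ap g k)"
        using f g by (intro bexI[of _ ?g]) auto
    qed
  qed simp_all
  with assms that show thesis by blast
qed

text \<open>Closure of a tree concerns concatenations, and the segment of length \<open>Su n\<close>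
  is the segment of length \<open>n\<close> followed by one value. Iterating this single step by
  induction on \<open>n\<close> removes the need to name the part between \<open>m\<close> and
  \<open>n\<close>.\<close>

lemma tree_initseg:
  assumes T: "T \<in> D ty1" "tree T" and \<beta>: "\<beta> \<in> D ty1" "bin \<beta>"
    and mn: "m \<in> \<N>" "n \<in> \<N>" "le m n" and "ap T (code (ini \<beta> n)) = Su Z"
  shows "ap T (code (ini \<beta> m)) = Su Z"
proof -
  have "le m n \<longrightarrow> ap T (code (ini \<beta> n)) = Su Z \<longrightarrow> ap T (code (ini \<beta> m)) = Su Z"
  \<comment> \<open>The parameters are held by the assignment, \<open>T\<close> under
    \<open>vf\<close> and \<open>\<beta>\<close> under \<open>vg\<close>.\<close>
  proof (rule formula_induct[OF mn(2), where \<rho> = "\<rho>0(vm := m, vf := T, vg := \<beta>)"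
        and P = "\<lambda>n. le m n \<longrightarrow> ap T (code (ini \<beta> n)) = Su Z \<longrightarrow> ap T (code (ini \<beta> m)) = Su Z"
        and \<phi> = "Le (Var vm) (Var vn) \<^bold>\<longrightarrow> InTree (initseg (Var vg) (Var vn)) (Var vf) \<^bold>\<longrightarrow>
          InTree (initseg (Var vg) (Var vm)) (Var vf)"])
    fix n assume n: "n \<in> \<N>"
      and IH: "le m n \<longrightarrow> ap T (code (ini \<beta> n)) = Su Z \<longrightarrow> ap T (code (ini \<beta> m)) = Su Z"
    let ?v = "Cs TNat (ap \<beta> n) (Nl TNat)"
    have b1: "binseq (ini \<beta> n)"
      using \<beta> n by (simp add: binseq_def entry_ini bin_def)
    have b2: "binseq ?v"
      unfolding binseq_def
    proof (intro ballI HOL.impI)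
      fix i assume i: "i \<in> \<N>" "le (Su i) (ln TNat ?v)"
      then have "i = Z" using \<beta> n by simp
      then show "le (ent TNat ?v i) (Su Z)" using \<beta> n by (simp add: bin_def)
    qed
    have "ini \<beta> n \<in> D (TSeq TNat)" "?v \<in> D (TSeq TNat)"
      using \<beta> n by simp_all
    from bspec[OF bspec[OF conjunct2[OF T(2)[unfolded tree_def]] this(1)] this(2)] b1 b2
    have "ap T (code (app TNat (ini \<beta> n) ?v)) = Su Z \<longrightarrow> ap T (code (ini \<beta> n)) = Su Z"
      by iprover
    then have "ap T (code (ini \<beta> n)) = Su Z" if "ap T (code (ini \<beta> (Su n))) = Su Z"
      using that \<beta> n by (simp add: val_initseg(2))
    with IH le_SuE[of n m] mn n
    show "le m (Su n) \<longrightarrow> ap T (code (ini \<beta> (Su n))) = Su Z \<longrightarrow> ap T (code (ini \<beta> m)) = Su Z"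
      by auto
  qed (use mn T \<beta> in \<open>auto simp: InTree_def\<close>)
  with assms show ?thesis by blast
qed

section \<open>The three principles in a model and the implications between them\<close>

definition muc :: "'e \<Rightarrow> bool" where
  "muc \<Omega> \<longleftrightarrow> (\<forall>Y\<in>D ty2. \<forall>f\<in>D ty1. bin f \<longrightarrow> (\<forall>g\<in>D ty1. bin g \<longrightarrow>
    ini f (ap \<Omega> Y) = ini g (ap \<Omega> Y) \<longrightarrow> ap Y f = ap Y g))"

definition sff :: "'e \<Rightarrow> bool" where
  "sff \<Theta> \<longleftrightarrow> (\<forall>G\<in>D ty2. \<forall>f\<in>D ty1. bin f \<longrightarrow> (\<exists>g\<in>D ty1. mem ty1 g (ap \<Theta> G) \<and>
    extends f (ini g (ap G g))))"

definition fanef :: "'e \<Rightarrow> bool" where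
  "fanef h \<longleftrightarrow> (\<forall>T\<in>D ty1. tree T \<longrightarrow> (\<forall>g\<in>D ty2.
    (\<forall>\<alpha>\<in>D ty1. bin \<alpha> \<longrightarrow> ap T (code (ini \<alpha> (ap g \<alpha>))) \<noteq> Su Z) \<longrightarrow>
    (\<forall>\<beta>\<in>D ty1. bin \<beta> \<longrightarrow>
      ap T (code (ini \<beta> (ap h (ap (ap (cn (Pairc ty2 ty1)) g) T)))) \<noteq> Su Z)))"

lemma ap_in3 [simp]: "h \<in> D (ty2 \<rightarrow>\<^sub>T \<tau>) \<Longrightarrow> G \<in> D ty2 \<Longrightarrow> ap h G \<in> D \<tau>"
  by (rule ap_in)

text \<open>By \<open>muc\<close>, \<open>G\<close> takes on binary functions only values that it takes on \<open>binseqs N\<close>, so \<open>M\<close>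
  bounds \<open>G\<close> on all of them.\<close>

lemma muc_imp_sff:
  assumes \<Omega>: "\<Omega> \<in> D (ty2 \<rightarrow>\<^sub>T TNat)" "muc \<Omega>"
    and \<Theta>: "\<And>G. G \<in> D ty2 \<Longrightarrow>
      ap \<Theta> G = binseqs (pls (ap \<Omega> G) (sm G (binseqs (ap \<Omega> G))))"
  shows "sff \<Theta>"
  unfolding sff_def
proof (intro ballI HOL.impI)
  fix G f assume G: "G \<in> D ty2" and f: "f \<in> D ty1" "bin f"
  define N where "N = ap \<Omega> G"
  define M where "M = sm G (binseqs N)"
  have N: "N \<in> \<N>" using \<Omega> G by (simp add: N_def)
  then have M: "M \<in> \<N>" using G by (simp add: M_def)
  \<comment> \<open>Length at least \<open>N\<close> lets \<open>muc\<close> transfer values of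
    \<open>G\<close>; length at least \<open>M\<close> covers the segment to be matched.\<close>
  let ?K = "pls N M"
  have eqG: "ap G f = ap G g"
    if "g \<in> D ty1" "bin g" "\<And>k. k \<in> \<N> \<Longrightarrow> le (Su k) N \<Longrightarrow> ap f k = ap g k" for g
    using \<Omega>(2) G f that ini_eqI[OF f(1) that(1) N that(3)] unfolding muc_def N_def by blast
  \<comment> \<open>\<open>g0\<close> only bounds \<open>ap G f\<close>: it occurs in the sequence
    summed by \<open>M\<close>. The function that witnesses the claim is \<open>g\<close> below,
    which agrees with \<open>f\<close> further.\<close>
  obtain g0 where g0: "g0 \<in> D ty1" "mem ty1 g0 (binseqs N)" "bin g0"
    "\<And>k. k \<in> \<N> \<Longrightarrow> le (Su k) N \<Longrightarrow> ap f k = ap g0 k"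
    using binseqs_complete[OF N f] by blast
  have "ap G f = ap G g0" using eqG g0 by blast
  then have fM: "le (ap G f) M" using le_sum[OF G _ g0(2)] N by (simp add: M_def)
  obtain g where g: "g \<in> D ty1" "mem ty1 g (binseqs ?K)" "bin g"
    "\<And>k. k \<in> \<N> \<Longrightarrow> le (Su k) ?K \<Longrightarrow> ap f k = ap g k"
    using binseqs_complete[of ?K f] N M f by auto
  have "le (Su k) ?K" if "k \<in> \<N>" "le (Su k) N" for k
    using le_trans[of "Su k" N ?K] le_plus1[of N M] that N M by simp
  then have "ap G f = ap G g" using eqG g by blast
  \<comment> \<open>The agreement below \<open>?K\<close> reaches the length \<open>ap G g\<close>,
    although this length is determined by \<open>g\<close> itself.\<close>
  then have gK: "le (ap G g) ?K"
    using le_trans[of "ap G g" M ?K] le_plus2[of N M] fM N M G g by simp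
  have "extends f (ini g (ap G g))"
    unfolding extends_def
  proof (intro ballI HOL.impI)
    fix i assume "i \<in> \<N>" "le (Su i) (ln TNat (ini g (ap G g)))"
    then have i: "i \<in> \<N>" "le (Su i) (ap G g)" using g G by simp_all
    then have "le (Su i) ?K" using le_trans[of "Su i" "ap G g" ?K] gK N M G g by simp
    then show "ap f i = ent TNat (ini g (ap G g)) i"
      using g i G by (simp add: entry_ini)
  qed
  with g \<Theta>[OF G] show "\<exists>g\<in>D ty1. mem ty1 g (ap \<Theta> G) \<and> extends f (ini g (ap G g))"
    unfolding N_def M_def by auto
qed

text \<open>The elements of \<open>\<Theta> G\<close> need not be binary, hence the detour through \<open>clip\<close>: an initial segment
  shared with a binary function is unchanged by clipping.\<close>

lemma sff_imp_fanef:
  assumes \<Theta>: "\<Theta> \<in> D (ty2 \<rightarrow>\<^sub>T TSeq ty1)" "sff \<Theta>"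
    and h: "\<And>g T. g \<in> D ty2 \<Longrightarrow> T \<in> D ty1 \<Longrightarrow> \<exists>G\<in>D ty2. (\<forall>a\<in>D ty1. ap G a = ap g (clip a)) \<and>
      ap h (ap (ap (cn (Pairc ty2 ty1)) g) T) = sm G (ap \<Theta> G)"
  shows "fanef h"
  unfolding fanef_def
proof (intro ballI HOL.impI notI)
  fix T g \<beta>
  assume T: "T \<in> D ty1" "tree T" and g: "g \<in> D ty2"
    and bar: "\<forall>\<alpha>\<in>D ty1. bin \<alpha> \<longrightarrow> ap T (code (ini \<alpha> (ap g \<alpha>))) \<noteq> Su Z"
    and \<beta>: "\<beta> \<in> D ty1" "bin \<beta>"
    and inT: "ap T (code (ini \<beta> (ap h (ap (ap (cn (Pairc ty2 ty1)) g) T)))) = Su Z"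
  obtain G where G: "G \<in> D ty2" "\<And>a. a \<in> D ty1 \<Longrightarrow> ap G a = ap g (clip a)"
    "ap h (ap (ap (cn (Pairc ty2 ty1)) g) T) = sm G (ap \<Theta> G)"
    using h[OF g T(1)] by blast
  obtain \<gamma> where \<gamma>: "\<gamma> \<in> D ty1" "mem ty1 \<gamma> (ap \<Theta> G)" "extends \<beta> (ini \<gamma> (ap G \<gamma>))"
    using \<Theta>(2) G(1) \<beta> unfolding sff_def by blast
  \<comment> \<open>Evaluating \<open>g\<close> at the clipped function makes \<open>k\<close> a
    length to which the bar hypothesis applies, as that hypothesis covers binary functions
    only.\<close>
  define k where "k = ap g (clip \<gamma>)"
  have k: "k \<in> \<N>" "ap G \<gamma> = k" using g \<gamma> G by (simp_all add: k_def)
  have eq: "ap \<beta> i = ap (clip \<gamma>) i" if i: "i \<in> \<N>" "le (Su i) k" for i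
  proof -
    have "ap \<beta> i = ap \<gamma> i"
      using \<gamma>(1,3) i k unfolding extends_def by (simp add: entry_ini)
    moreover have "le (ap \<beta> i) (Su Z)" using \<beta> i by (simp add: bin_def)
    ultimately show ?thesis using clip_id[of \<gamma> i] \<gamma>(1) i by simp
  qed
  have \<Theta>G: "ap \<Theta> G \<in> D (TSeq ty1)" using \<Theta>(1) G(1) by simp
  \<comment> \<open>\<open>k\<close> is one summand of the value of \<open>h\<close>, so the segment
    of \<open>\<beta>\<close> in \<open>T\<close> can be shortened to length
    \<open>k\<close>.\<close>
  have le: "le k (sm G (ap \<Theta> G))" using le_sum[OF G(1) \<Theta>G \<gamma>(2)] k(2) by simp
  have "sm G (ap \<Theta> G) \<in> \<N>" using G(1) \<Theta>G by simp
  then have inT': "ap T (code (ini \<beta> k)) = Su Z"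
    using inT[unfolded G(3)] by (rule tree_initseg[OF T \<beta> k(1) _ le])
  have clip: "clip \<gamma> \<in> D ty1" "bin (clip \<gamma>)" using \<gamma>(1) bin_clip by simp_all
  \<comment> \<open>The shortened segment is also one of \<open>clip \<gamma>\<close>, of exactly
    the length at which the bar hypothesis puts it outside \<open>T\<close>.\<close>
  have "ini \<beta> k = ini (clip \<gamma>) k" by (rule ini_eqI[OF \<beta>(1) clip(1) k(1) eq])
  with inT' bar clip show False unfolding k_def by metis
qed

end

section \<open>The closed terms of the theorem and their meaning in a model\<close>

definition fan_tm :: tm where
  "fan_tm =
    (let Om = (''O'', ty2 \<rightarrow>\<^sub>T TNat); G = (''G'', ty2) in
     lam Om (lam G (binseqs_tm \<cdot> (plus_tm \<cdot> (Var Om \<cdot> Var G) \<cdot>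
       (sum_tm \<cdot> Var G \<cdot> (binseqs_tm \<cdot> (Var Om \<cdot> Var G)))))))"

definition clipped_tm :: tm where
  "clipped_tm = (let g = (''g'', ty2); f = (''f'', ty1) in lam g (lam f (Var g \<cdot> (clip_tm \<cdot> Var f))))"

definition bound_tm :: tm where
  "bound_tm =
    (let Th = (''t'', ty2 \<rightarrow>\<^sub>T TSeq ty1); q = (''q'', ty2 \<times>\<^sub>T ty1);
         G = clipped_tm \<cdot> (Con (Fstc ty2 ty1) \<cdot> Var q) in
     lam Th (lam q (sum_tm \<cdot> G \<cdot> (Var Th \<cdot> G))))"

lemma fan_tm_simps [simp]:
  "tyof fan_tm = Some ((ty2 \<rightarrow>\<^sub>T TNat) \<rightarrow>\<^sub>T ty2 \<rightarrow>\<^sub>T TSeq ty1)" "vars fan_tm = {}"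
  by (auto simp: fan_tm_def Let_def)

lemma clipped_tm_simps [simp]: "tyof clipped_tm = Some (ty2 \<rightarrow>\<^sub>T ty2)" "vars clipped_tm = {}"
  by (auto simp: clipped_tm_def Let_def)

lemma bound_tm_simps [simp]:
  "tyof bound_tm = Some ((ty2 \<rightarrow>\<^sub>T TSeq ty1) \<rightarrow>\<^sub>T (ty2 \<times>\<^sub>T ty1) \<rightarrow>\<^sub>T TNat)" "vars bound_tm = {}"
  by (auto simp: bound_tm_def Let_def)

context model
begin

lemmas ev_vals' [simp] =
  ev_val[OF fan_tm_simps(2)] ev_val[OF clipped_tm_simps(2)] ev_val[OF bound_tm_simps(2)]

lemma val_clipped:
  assumes "g \<in> D ty2"
  shows "ap (val clipped_tm) g \<in> D ty2"
    "f \<in> D ty1 \<Longrightarrow> ap (ap (val clipped_tm) g) f = ap g (clip f)"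
proof -
  show "ap (val clipped_tm) g \<in> D ty2"
    using ap_in val_in[OF clipped_tm_simps(2,1)] assms by blast
  show "ap (ap (val clipped_tm) g) f = ap g (clip f)" if "f \<in> D ty1"
    using that assms unfolding val_def[of clipped_tm] unfolding clipped_tm_def by (simp add: compute)
qed

lemma val_fan:
  "\<Omega> \<in> D (ty2 \<rightarrow>\<^sub>T TNat) \<Longrightarrow> G \<in> D ty2 \<Longrightarrow> ap (ap (val fan_tm) \<Omega>) G =
    binseqs (pls (ap \<Omega> G) (sm G (binseqs (ap \<Omega> G))))"
  unfolding val_def[of fan_tm] unfolding fan_tm_def by (simp add: compute)

lemma val_bound:
  assumes "\<Theta> \<in> D (ty2 \<rightarrow>\<^sub>T TSeq ty1)" "g \<in> D ty2" "T \<in> D ty1"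
  defines "G \<equiv> ap (val clipped_tm) g"
  shows "ap (ap (val bound_tm) \<Theta>) (ap (ap (cn (Pairc ty2 ty1)) g) T) = sm G (ap \<Theta> G)"
proof -
  have "ap (ap (cn (Pairc ty2 ty1)) g) T \<in> D (ty2 \<times>\<^sub>T ty1)"
    using ap_in[OF ap_in] cn_in[of "Pairc ty2 ty1"] assms by simp
  then show ?thesis
    using assms unfolding val_def[of bound_tm] unfolding bound_tm_def by (simp add: compute Fst)
qed

lemma sat_MUC: "\<Omega> \<in> D (ty2 \<rightarrow>\<^sub>T TNat) \<Longrightarrow>
    sat (\<rho>((''Omega'', ty2 \<rightarrow>\<^sub>T TNat) := \<Omega>)) (MUC (Var (''Omega'', ty2 \<rightarrow>\<^sub>T TNat))) \<longleftrightarrow> muc \<Omega>"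
  by (simp add: MUC_def Let_def muc_def)

lemma sat_SFF:
  "(''G'', ty2) \<notin> vars \<Theta> \<Longrightarrow> (''f'', ty1) \<notin> vars \<Theta> \<Longrightarrow> (''g'', ty1) \<notin> vars \<Theta> \<Longrightarrow>
    (''i'', TNat) \<notin> vars \<Theta> \<Longrightarrow> sat \<rho> (SFF \<Theta>) \<longleftrightarrow> sff (ev \<rho> \<Theta>)"
  by (simp add: SFF_def Let_def sff_def ev_upd_fresh)

lemma sat_FANef:
  "(''T'', ty1) \<notin> vars h \<Longrightarrow> (''g'', ty2) \<notin> vars h \<Longrightarrow> (''alpha'', ty1) \<notin> vars h \<Longrightarrow>
    (''beta'', ty1) \<notin> vars h \<Longrightarrow> sat \<rho> (FANef h) \<longleftrightarrow> fanef (ev \<rho> h)"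
  by (simp add: FANef_def InTree_def Let_def fanef_def ev_upd_fresh)

end

section \<open>Typing and variable conditions for the completeness theorem\<close>

lemma MUC_simps [simp]:
  "tyof \<Omega> = Some (ty2 \<rightarrow>\<^sub>T TNat) \<Longrightarrow> wff (MUC \<Omega>)"
  "bvs (MUC \<Omega>) \<inter> W = {}"
  "fvs (MUC \<Omega>) \<subseteq> vars \<Omega>"
  unfolding MUC_def Let_def by (simp, simp, auto)

lemma SFF_simps [simp]:
  "tyof \<Theta> = Some (ty2 \<rightarrow>\<^sub>T TSeq ty1) \<Longrightarrow> wff (SFF \<Theta>)"
  "bvs (SFF \<Theta>) \<inter> W = {}"
  "fvs (SFF \<Theta>) \<subseteq> vars \<Theta>"
  unfolding SFF_def Let_def by (simp, simp, auto)

lemma Tree_simps [simp]: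
  "tyof T = Some ty1 \<Longrightarrow> wff (Tree T)"
  "bvs (Tree T) \<inter> W = {}"
  "fvs (Tree T) \<subseteq> vars T"
  unfolding Tree_def InTree_def Let_def by (simp, simp, auto)

lemma FANef_simps [simp]:
  "tyof h = Some (ty2 \<times>\<^sub>T ty1 \<rightarrow>\<^sub>T TNat) \<Longrightarrow> wff (FANef h)"
  "bvs (FANef h) \<inter> W = {}"
  "fvs (FANef h) \<subseteq> vars h"
  using Tree_simps(3)[of "Var (''T'', ty1)"]
  unfolding FANef_def InTree_def Let_def by (simp, simp add: Int_Un_distrib2, auto)

theorem theorem3p4:
  shows "\<exists>s t.
    closed_term s ((ty2 \<rightarrow>\<^sub>T TSeq ty1) \<rightarrow>\<^sub>T (ty2 \<times>\<^sub>T ty1) \<rightarrow>\<^sub>T TNat) \<and>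
    closed_term t ((ty2 \<rightarrow>\<^sub>T TNat) \<rightarrow>\<^sub>T ty2 \<rightarrow>\<^sub>T TSeq ty1) \<and>
    (let \<Omega> = (''Omega'', ty2 \<rightarrow>\<^sub>T TNat); \<Theta> = (''Theta'', ty2 \<rightarrow>\<^sub>T TSeq ty1) in
     {} \<turnstile>
       Forall \<Omega> (MUC (Var \<Omega>) \<^bold>\<longrightarrow> SFF (t \<cdot> Var \<Omega>)) \<^bold>\<and>
       Forall \<Theta> (SFF (Var \<Theta>) \<^bold>\<longrightarrow> FANef (s \<cdot> Var \<Theta>)))"
proof -
  let ?\<Omega> = "(''Omega'', ty2 \<rightarrow>\<^sub>T TNat)" and ?\<Theta> = "(''Theta'', ty2 \<rightarrow>\<^sub>T TSeq ty1)"
  let ?\<phi> = "Forall ?\<Omega> (MUC (Var ?\<Omega>) \<^bold>\<longrightarrow> SFF (fan_tm \<cdot> Var ?\<Omega>)) \<^bold>\<and>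
    Forall ?\<Theta> (SFF (Var ?\<Theta>) \<^bold>\<longrightarrow> FANef (bound_tm \<cdot> Var ?\<Theta>))"
  have "{} \<turnstile> ?\<phi>"
  \<comment> \<open>Both implications are closed and bind only names of at most five letters, so
    truth in every model yields a derivation.\<close>
  proof (rule completeness)
    fix D :: "ty \<Rightarrow> tm set set" and ap cn \<rho>
    assume "model D ap cn"
    then interpret model D ap cn .
    have "sff (ap (val fan_tm) \<Omega>)" if "\<Omega> \<in> D (snd ?\<Omega>)" "muc \<Omega>" for \<Omega>
      using that by (intro muc_imp_sff[of \<Omega>]) (simp_all add: val_fan)
    moreover have "fanef (ap (val bound_tm) \<Theta>)" if "\<Theta> \<in> D (snd ?\<Theta>)" "sff \<Theta>" for \<Theta>
    proof (rule sff_imp_fanef[of \<Theta>])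
      fix g T assume "g \<in> D ty2" "T \<in> D ty1"
      with that show "\<exists>G\<in>D ty2. (\<forall>a\<in>D ty1. ap G a = ap g (ap (val clip_tm) a)) \<and>
          ap (ap (val bound_tm) \<Theta>) (ap (ap (cn (Pairc ty2 ty1)) g) T) =
          ap (ap (val sum_tm) G) (ap \<Theta> G)"
        \<comment> \<open>The required \<open>G\<close> exists as an element of the model because
          composition with clipping is given by a closed term.\<close>
        by (intro bexI[of _ "ap (val clipped_tm) g"]) (simp_all add: val_clipped val_bound)
    qed (use that in simp_all)
    ultimately show "sat \<rho> ?\<phi>"
      by (simp add: sat_MUC sat_SFF sat_FANef)
  next
    show "fvs ?\<phi> = {}"
      using MUC_simps(3)[of "Var ?\<Omega>"] SFF_simps(3)[of "fan_tm \<cdot> Var ?\<Omega>"]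
        SFF_simps(3)[of "Var ?\<Theta>"] FANef_simps(3)[of "bound_tm \<cdot> Var ?\<Theta>"] by auto
    show "bvs ?\<phi> \<inter> W = {}" by (simp add: Int_Un_distrib2)
  qed simp_all
  then show ?thesis
    by (intro HOL.exI[of _ bound_tm] HOL.exI[of _ fan_tm]) (simp add: closed_term_def)
qed

end
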